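(* Let $f$ be a nonzero function on $\{0,1\}^n$, let $0 \le \epsilon < 1/2$ and $p=1+(1-2\epsilon)^2$. Then \[ \|T_\epsilon f\|_2 ~\le~ 2^{\eta\left(r(p),\,\epsilon\right) \cdot n} \cdot \|f\|_{p}. \] Moreover there is an absolute constant $C$ such that, for every integer $1\le s\le\frac n2$, if $f=c\cdot 1_S$ with $c\neq0$ and $S$ a Hamming sphere of radius $s$, then $2^{\eta(r(p),\epsilon)n}\|f\|_p\le C s^{3/4}\|T_\epsilon f\|_2$.
   Context: Norms are with respect to the uniform measure: $\|f\|_q=(2^{-n}\sum_x|f(x)|^q)^{1/q}$. For $f\ne0$, $r(q)=r_f(q)=\frac1n\log_2\frac{\|f\|_q}{\|f\|_1}$ (so $0\le r(q)\le \frac{q-1}q$). The noise operator is $(T_\epsilon f)(x)=\sum_{y}\epsilon^{|y-x|}(1-\epsilon)^{n-|y-x|}f(y)$. $H$ is binary entropy, $H^{-1}:[0,1]\to[0,\frac12]$ its inverse on $[0,\frac12]$. For $0\le\sigma,\delta\le\frac12$, $\alpha_{\sigma,\delta}(x)=\sigma H(\frac x\sigma)+(1-\sigma)H(\frac x{1-\sigma})+2x\log_2\delta+(1-2x)\log_2(1-\delta)$ and $\phi(\sigma,\delta)=H(\sigma)-1+\max_{0\le x\le\sigma}\alpha_{\sigma,\delta}(x)$; $\tilde\phi(y,\delta)=\phi(H^{-1}(y),\delta)$ for $0\le y\le1$. For $q>1$, $0\le x\le\frac{q-1}q$: $\eta_q(x,\epsilon)=\frac12\tilde\phi\left(1-\frac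 q{q-1}x,\,2\epsilon(1-\epsilon)\right)+\frac{x}{q-1}$, and $\eta(x,\epsilon)=\eta_{1+(1-2\epsilon)^2}(x,\epsilon)$. *)

theory Defs
  imports "HOL-Analysis.Analysis" "HOL-Real_Asymp.Real_Asymp"
begin

text \<open>Points of \<open>{0,1}^n\<close> are Boolean lists of length \<open>n\<close>. A function on the cube is a function on
  all Boolean lists; only its values on \<open>cube n\<close> matter.\<close>

definition cube :: "nat \<Rightarrow> bool list set" where
  "cube n = {x. length x = n}"

definition hdist :: "bool list \<Rightarrow> bool list \<Rightarrow> nat" where
  "hdist x y = card {i. i < length x \<and> x ! i \<noteq> y ! i}"

definition hsphere :: "nat \<Rightarrow> bool list \<Rightarrow> nat \<Rightarrow> bool list set" where
  "hsphere n z s = {x \<in> cube n. hdist x z = s}"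

definition cnorm :: "nat \<Rightarrow> real \<Rightarrow> (bool list \<Rightarrow> real) \<Rightarrow> real" where
  "cnorm n q f = ((\<Sum>x\<in>cube n. \<bar>f x\<bar> powr q) / 2 ^ n) powr (1 / q)"

definition rnorm :: "nat \<Rightarrow> (bool list \<Rightarrow> real) \<Rightarrow> real \<Rightarrow> real" where
  "rnorm n f q = 1 / real n * log 2 (cnorm n q f / cnorm n 1 f)"

definition noise :: "nat \<Rightarrow> real \<Rightarrow> (bool list \<Rightarrow> real) \<Rightarrow> bool list \<Rightarrow> real" where
  "noise n \<epsilon> f x = (\<Sum>y\<in>cube n. \<epsilon> ^ hdist y x * (1 - \<epsilon>) ^ (n - hdist y x) * f y)"

text \<open>At the end points \<open>0 * log 2 0 = 0\<close>, as usual.\<close>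

definition bin_entropy :: "real \<Rightarrow> real" where
  "bin_entropy x = - x * log 2 x - (1 - x) * log 2 (1 - x)"

definition bin_entropy_inv :: "real \<Rightarrow> real" where
  "bin_entropy_inv = the_inv_into {0..1/2} bin_entropy"

text \<open>The term \<open>2 * x * log 2 \<delta>\<close> of \<open>\<alpha>\<close> is \<open>-\<infinity>\<close> for \<open>\<delta> = 0 < x\<close> and \<open>0\<close> for \<open>\<delta> = x = 0\<close>, whereas
  \<open>log 2 0\<close> is \<open>0\<close> on the reals. Hence \<open>\<alpha>\<close> takes values in the extended reals, where \<open>0 * -\<infinity> = 0\<close>.\<close>

definition elog2 :: "real \<Rightarrow> ereal" where
  "elog2 t = (if t = 0 then -\<infinity> else ereal (log 2 t))"

definition alpha :: "real \<Rightarrow> real \<Rightarrow> real \<Rightarrow> ereal" where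
  "alpha \<sigma> \<delta> x = ereal (\<sigma> * bin_entropy (x / \<sigma>) + (1 - \<sigma>) * bin_entropy (x / (1 - \<sigma>)))
     + ereal (2 * x) * elog2 \<delta> + ereal (1 - 2 * x) * elog2 (1 - \<delta>)"

text \<open>The supremum is a maximum and is finite; see \<open>alpha_max_attained\<close>.\<close>

definition phi :: "real \<Rightarrow> real \<Rightarrow> real" where
  "phi \<sigma> \<delta> = bin_entropy \<sigma> - 1 + real_of_ereal (SUP x\<in>{0..\<sigma>}. alpha \<sigma> \<delta> x)"

definition phi_tilde :: "real \<Rightarrow> real \<Rightarrow> real" where
  "phi_tilde y \<delta> = phi (bin_entropy_inv y) \<delta>"

definition eta_q :: "real \<Rightarrow> real \<Rightarrow> real \<Rightarrow> real" where
  "eta_q q x \<epsilon> = 1/2 * phi_tilde (1 - q / (q - 1) * x) (2 * \<epsilon> * (1 - \<epsilon>)) + x / (q - 1)"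

definition eta :: "real \<Rightarrow> real \<Rightarrow> real" where
  "eta x \<epsilon> = eta_q (1 + (1 - 2 * \<epsilon>)\<^sup>2) x \<epsilon>"

lemma continuous_on_xlog2: "continuous_on {0..} (\<lambda>x::real. x * log 2 x)"
proof -
  have "continuous (at x within {0..}) (\<lambda>x::real. x * log 2 x)" if "x \<ge> 0" for x
  proof (cases "x = 0")
    case True
    have "((\<lambda>x::real. x * log 2 x) \<longlongrightarrow> 0) (at_right 0)"
      by real_asymp
    then show ?thesis
      using True by (simp add: continuous_within at_within_Ici_at_right)
  next
    case False
    then have "isCont (\<lambda>x::real. x * log 2 x) x"
      using that by (auto intro!: continuous_intros)
    then show ?thesis
      by (rule continuous_at_imp_continuous_at_within)
  qed
  then show ?thesis
    by (auto simp: continuous_on_eq_continuous_within)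
qed

lemma continuous_on_bin_entropy: "continuous_on {0..1} bin_entropy"
proof -
  have "continuous_on {0..1} (\<lambda>x::real. x * log 2 x)"
    by (rule continuous_on_subset[OF continuous_on_xlog2]) auto
  moreover have "continuous_on {0..1} (\<lambda>x::real. (1 - x) * log 2 (1 - x))"
    by (rule continuous_on_compose2[OF continuous_on_xlog2, of "{0..1}" "\<lambda>x. 1 - x"])
      (auto intro!: continuous_intros)
  ultimately have "continuous_on {0..1} (\<lambda>x::real. - (x * log 2 x) - (1 - x) * log 2 (1 - x))"
    by (intro continuous_on_diff continuous_on_minus)
  then show ?thesis
    by (simp add: bin_entropy_def[abs_def])
qed

lemma alpha_0: "\<delta> \<noteq> 1 \<Longrightarrow> alpha \<sigma> \<delta> 0 = ereal (log 2 (1 - \<delta>))"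
  by (simp add: alpha_def elog2_def bin_entropy_def zero_ereal_def[symmetric] one_ereal_def[symmetric])

lemma alpha_max_attained:
  assumes "0 \<le> \<sigma>" "\<sigma> \<le> 1/2" "0 \<le> \<delta>" "\<delta> \<le> 1/2"
  shows "\<exists>x\<in>{0..\<sigma>}. (\<forall>y\<in>{0..\<sigma>}. alpha \<sigma> \<delta> y \<le> alpha \<sigma> \<delta> x) \<and> \<bar>alpha \<sigma> \<delta> x\<bar> \<noteq> \<infinity>
           \<and> (SUP y\<in>{0..\<sigma>}. alpha \<sigma> \<delta> y) = alpha \<sigma> \<delta> x"
proof -
  have "\<exists>x\<in>{0..\<sigma>}. (\<forall>y\<in>{0..\<sigma>}. alpha \<sigma> \<delta> y \<le> alpha \<sigma> \<delta> x) \<and> \<bar>alpha \<sigma> \<delta> x\<bar> \<noteq> \<infinity>"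
  proof (cases "\<delta> = 0 \<or> \<sigma> = 0")
    case True
    have "alpha \<sigma> \<delta> y \<le> alpha \<sigma> \<delta> 0" if "y \<in> {0..\<sigma>}" for y
    proof (cases "y = 0")
      case False
      then have "\<delta> = 0" "y > 0" using True that by auto
      then show ?thesis by (simp add: alpha_def elog2_def)
    qed simp
    moreover have "\<bar>alpha \<sigma> \<delta> 0\<bar> \<noteq> \<infinity>" using assms by (simp add: alpha_0)
    ultimately show ?thesis using assms by (intro bexI[of _ 0]) auto
  next
    case False
    define g where "g = (\<lambda>x. \<sigma> * bin_entropy (x / \<sigma>) + (1 - \<sigma>) * bin_entropy (x / (1 - \<sigma>))
      + 2 * x * log 2 \<delta> + (1 - 2 * x) * log 2 (1 - \<delta>))"
    have \<sigma>: "\<sigma> > 0" using False assms by auto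
    have ag: "alpha \<sigma> \<delta> x = ereal (g x)" for x
      using False assms by (auto simp: alpha_def elog2_def g_def)
    have "continuous_on {0..\<sigma>} (\<lambda>x. bin_entropy (x / \<sigma>))"
      by (rule continuous_on_compose2[OF continuous_on_bin_entropy])
        (use \<sigma> in \<open>auto intro!: continuous_intros\<close>)
    moreover have "continuous_on {0..\<sigma>} (\<lambda>x. bin_entropy (x / (1 - \<sigma>)))"
      by (rule continuous_on_compose2[OF continuous_on_bin_entropy])
        (use \<sigma> assms in \<open>auto intro!: continuous_intros\<close>)
    ultimately have "continuous_on {0..\<sigma>} g"
      unfolding g_def by (intro continuous_intros)
    then obtain x where "x \<in> {0..\<sigma>}" "\<forall>y\<in>{0..\<sigma>}. g y \<le> g x"
      using continuous_attains_sup[of "{0..\<sigma>}" g] \<sigma> by auto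
    then show ?thesis by (intro bexI[of _ x]) (auto simp: ag)
  qed
  then obtain x where x: "x \<in> {0..\<sigma>}" "\<forall>y\<in>{0..\<sigma>}. alpha \<sigma> \<delta> y \<le> alpha \<sigma> \<delta> x"
    "\<bar>alpha \<sigma> \<delta> x\<bar> \<noteq> \<infinity>" by (elim bexE conjE)
  have "(SUP y\<in>{0..\<sigma>}. alpha \<sigma> \<delta> y) = alpha \<sigma> \<delta> x"
    by (rule antisym) (use x in \<open>auto intro: SUP_least SUP_upper\<close>)
  with x show ?thesis by (intro bexI[of _ x] conjI)
qed

end

theory Submission
  imports Defs
begin

text \<open>Put \<open>\<delta> = 2 \<epsilon> (1 - \<epsilon>)\<close>, so \<open>p = 2 (1 - \<delta>)\<close>. For \<open>1 \<le> r \<le> p\<close> the norm \<open>C\<^sub>r\<close> of \<open>T\<^sub>\<epsilon>\<close> from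
  \<open>L\<^sub>r\<close> to \<open>L\<^sub>2\<close> on the two-point space tensorises, and interpolating \<open>\<parallel>f\<parallel>\<^sub>r\<close> between \<open>\<parallel>f\<parallel>\<^sub>1\<close> and
  \<open>\<parallel>f\<parallel>\<^sub>p\<close> yields one bound for every \<open>r\<close>. The upper bound is the best of these: the function
  \<open>\<phi>\<close> of \<open>\<sigma> = H\<^sup>-\<^sup>1(y)\<close> is the Legendre dual of \<open>log C\<^sub>r\<close> in \<open>1/r\<close>, and for given \<open>\<sigma>\<close> the dual \<open>r\<close>
  is the one whose two-point extremiser \<open>(t, 1)\<close> satisfies \<open>t\<^sup>r = (1 - \<sigma>) / \<sigma>\<close>.

  For a sphere of radius \<open>s\<close>, Gibbs' inequality with the same \<open>t\<close> bounds \<open>\<phi>\<close> from above. Then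
  \<open>\<parallel>T\<^sub>\<epsilon> 1\<^sub>S\<parallel>\<^sub>2\<^sup>2\<close> is at least the bound times a product of three binomial point probabilities near
  their means (of \<open>s\<close> in \<open>n\<close>, and of a common \<open>k\<close> in \<open>s\<close> and in \<open>n - s\<close>). Each is of order at least
  \<open>s\<^sup>-\<^sup>1\<^sup>/\<^sup>2\<close>, which gives the factor \<open>s\<^sup>3\<^sup>/\<^sup>4\<close>.\<close>

section \<open>Binary entropy and the function \<open>\<phi>\<close>\<close>

lemma bin_entropy_strict_mono:
  assumes "0 \<le> a" "a < b" "b \<le> 1/2"
  shows "bin_entropy a < bin_entropy b"
proof (rule DERIV_pos_imp_increasing_open[OF assms(2)])
  fix x assume x: "a < x" "x < b"
  have x01: "0 < x" "x < 1" using x assms by auto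
  have eq: "bin_entropy = (\<lambda>x. (- (x * ln x) - (1 - x) * ln (1 - x)) / ln 2)"
    by (simp add: fun_eq_iff bin_entropy_def log_def diff_divide_distrib)
  have "((\<lambda>x. (- (x * ln x) - (1 - x) * ln (1 - x)) / ln 2)
      has_real_derivative ((- (ln x + 1) - (- ln (1 - x) - 1)) / ln 2)) (at x)"
    using x01 by (auto intro!: derivative_eq_intros)
  then have "(bin_entropy has_real_derivative (log 2 (1 - x) - log 2 x)) (at x)"
    unfolding eq by (simp add: log_def diff_divide_distrib)
  moreover have "log 2 x < log 2 (1 - x)" using x assms by simp
  ultimately show "\<exists>y. (bin_entropy has_real_derivative y) (at x) \<and> 0 < y"
    by (intro exI[of _ "log 2 (1 - x) - log 2 x"]) auto
next
  show "continuous_on {a..b} bin_entropy"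
    by (rule continuous_on_subset[OF continuous_on_bin_entropy]) (use assms in auto)
qed

text \<open>The inverse is meaningful where \<open>bin_entropy\<close> is injective and onto: strict
  monotonicity gives the first, the intermediate value theorem between the values 0 and 1 at the end
  points the second.\<close>

lemma bin_entropy_inv:
  assumes "0 \<le> y" "y \<le> 1"
  shows "0 \<le> bin_entropy_inv y" "bin_entropy_inv y \<le> 1/2" "bin_entropy (bin_entropy_inv y) = y"
proof -
  have "inj_on bin_entropy {0..1/2}"
    by (rule linorder_inj_onI) (use bin_entropy_strict_mono in \<open>force+\<close>)
  moreover have "\<exists>x\<ge>0. x \<le> 1/2 \<and> bin_entropy x = y"
  proof (rule IVT')
    show "continuous_on {0..1/2} bin_entropy"
      by (rule continuous_on_subset[OF continuous_on_bin_entropy]) auto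
  qed (use assms in \<open>auto simp: bin_entropy_def log_divide\<close>)
  then have "y \<in> bin_entropy ` {0..1/2}" by auto
  ultimately show "0 \<le> bin_entropy_inv y" "bin_entropy_inv y \<le> 1/2" "bin_entropy (bin_entropy_inv y) = y"
    using the_inv_into_into[of bin_entropy "{0..1/2}" y "{0..1/2}"] f_the_inv_into_f[of bin_entropy "{0..1/2}" y]
    unfolding bin_entropy_inv_def by auto
qed

text \<open>The homogeneous form of entropy: clearing the denominator leaves only terms
  \<open>y * log 2 y\<close>, which are harmless at 0. For \<open>\<sigma> = 0\<close> both sides
  vanish.\<close>

lemma scaled_bin_entropy:
  assumes "0 \<le> x" "x \<le> \<sigma>"
  shows "\<sigma> * bin_entropy (x / \<sigma>) = \<sigma> * log 2 \<sigma> - x * log 2 x - (\<sigma> - x) * log 2 (\<sigma> - x)"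
proof (cases "\<sigma> = 0")
  case True
  then show ?thesis using assms by simp
next
  case False
  then have \<sigma>: "\<sigma> > 0" using assms by simp
  have 1: "\<sigma> * ((y / \<sigma>) * log 2 (y / \<sigma>)) = y * log 2 y - y * log 2 \<sigma>" if "y \<ge> 0" for y
    using that \<sigma> by (cases "y = 0") (simp_all add: log_divide algebra_simps)
  have "1 - x / \<sigma> = (\<sigma> - x) / \<sigma>" using \<sigma> by (simp add: field_simps)
  then have "\<sigma> * bin_entropy (x / \<sigma>)
      = - (\<sigma> * ((x / \<sigma>) * log 2 (x / \<sigma>))) - \<sigma> * (((\<sigma> - x) / \<sigma>) * log 2 ((\<sigma> - x) / \<sigma>))"
    by (simp add: bin_entropy_def right_diff_distrib)
  also have "\<dots> = \<sigma> * log 2 \<sigma> - x * log 2 x - (\<sigma> - x) * log 2 (\<sigma> - x)"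
    using assms by (subst (1 2) 1) (auto simp: algebra_simps)
  finally show ?thesis .
qed

text \<open>The hypothesis excludes exactly the case \<open>\<delta> = 0 < x\<close>, where \<open>\<alpha>\<close> is \<open>-\<infinity>\<close>. The first three
  summands are the entropy of the joint law of two bits with marginals \<open>(1 - \<sigma>, \<sigma>)\<close> that differ
  with probability \<open>2 * x\<close>.\<close>

lemma alpha_eq_joint_entropy:
  assumes "0 \<le> x" "x \<le> \<sigma>" "\<sigma> \<le> 1/2" "0 \<le> \<delta>" "\<delta> < 1" "\<delta> > 0 \<or> x = 0"
  shows "alpha \<sigma> \<delta> x = ereal (- 2 * (x * log 2 x) - (\<sigma> - x) * log 2 (\<sigma> - x)
     - (1 - \<sigma> - x) * log 2 (1 - \<sigma> - x) - bin_entropy \<sigma>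
     + 2 * x * log 2 \<delta> + (1 - 2 * x) * log 2 (1 - \<delta>))"
proof -
  have "alpha \<sigma> \<delta> x = ereal (\<sigma> * bin_entropy (x / \<sigma>) + (1 - \<sigma>) * bin_entropy (x / (1 - \<sigma>))
     + 2 * x * log 2 \<delta> + (1 - 2 * x) * log 2 (1 - \<delta>))"
    using assms by (auto simp: alpha_def elog2_def zero_ereal_def[symmetric])
  also have "\<sigma> * bin_entropy (x / \<sigma>) + (1 - \<sigma>) * bin_entropy (x / (1 - \<sigma>))
    = - 2 * (x * log 2 x) - (\<sigma> - x) * log 2 (\<sigma> - x)
     - (1 - \<sigma> - x) * log 2 (1 - \<sigma> - x) - bin_entropy \<sigma>"
    using assms by (subst (1 2) scaled_bin_entropy) (auto simp: bin_entropy_def algebra_simps)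
  finally show ?thesis .
qed

section \<open>Variational bounds for \<open>phi\<close>\<close>

lemma phi_ge:
  assumes "0 \<le> x" "x \<le> \<sigma>" "\<sigma> \<le> 1/2" "0 \<le> \<delta>" "\<delta> \<le> 1/2" "alpha \<sigma> \<delta> x = ereal v"
  shows "bin_entropy \<sigma> - 1 + v \<le> phi \<sigma> \<delta>"
proof -
  obtain x0 where x0: "x0 \<in> {0..\<sigma>}" "\<forall>y\<in>{0..\<sigma>}. alpha \<sigma> \<delta> y \<le> alpha \<sigma> \<delta> x0"
    "\<bar>alpha \<sigma> \<delta> x0\<bar> \<noteq> \<infinity>" "(SUP y\<in>{0..\<sigma>}. alpha \<sigma> \<delta> y) = alpha \<sigma> \<delta> x0"
    using alpha_max_attained[of \<sigma> \<delta>] assms by auto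
  have "ereal v \<le> alpha \<sigma> \<delta> x0" using bspec[OF x0(2), of x] assms by simp
  \<comment> \<open>Passing from \<open>ereal\<close> to \<open>real\<close> preserves the order
    because the maximum is finite.\<close>
  then have "v \<le> real_of_ereal (alpha \<sigma> \<delta> x0)"
    using x0(3) by (cases "alpha \<sigma> \<delta> x0") auto
  then show ?thesis by (simp add: phi_def x0(4))
qed

text \<open>One summand of Gibbs' inequality for a law \<open>p\<close> against weights
  \<open>w\<close> of total mass \<open>Z\<close>, from \<open>ln x \<le> x - 1\<close> at
  \<open>x = w / (Z * p)\<close>. The error term \<open>(w / Z - p) / ln 2\<close> lets each cell be
  treated separately; the errors cancel in the sum, where both \<open>w / Z\<close> and
  \<open>p\<close> have mass 1.\<close>

lemma gibbs_term_le:
  fixes p w Z :: real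
  assumes "0 \<le> p" "0 \<le> w" "0 < Z" "p = 0 \<or> w > 0"
  shows "p * log 2 w - p * log 2 p \<le> p * log 2 Z + (w / Z - p) / ln 2"
proof (cases "p = 0")
  case True
  then show ?thesis using assms by simp
next
  case False
  then have pw: "p > 0" "w > 0" using assms by auto
  then have "ln (w / (Z * p)) \<le> w / (Z * p) - 1" using assms by (intro ln_le_minus_one) auto
  then have "p * ln (w / (Z * p)) \<le> p * (w / (Z * p) - 1)" using pw by (intro mult_left_mono) auto
  also have "\<dots> = w / Z - p" using pw assms by (simp add: field_simps)
  also have "ln (w / (Z * p)) = ln w - ln Z - ln p" using pw assms by (simp add: ln_div ln_mult)
  finally have "(p * ln w - p * ln p - p * ln Z) / ln 2 \<le> (w / Z - p) / ln 2"
    by (intro divide_right_mono) (auto simp: algebra_simps)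
  then show ?thesis by (simp add: log_def diff_divide_distrib)
qed

text \<open>Gibbs' inequality for the law \<open>1 - \<sigma> - x\<close>, \<open>x\<close>,
  \<open>x\<close>, \<open>\<sigma> - x\<close> of two bits against the weights
  \<open>(1 - \<delta>) * t^2\<close>, \<open>\<delta> * t\<close>, \<open>\<delta> * t\<close>,
  \<open>1 - \<delta>\<close> of total mass \<open>Z\<close>. The exponent of \<open>t\<close> is
  \<open>2 * (1 - \<sigma> - x) + 2 * x = 2 * (1 - \<sigma>)\<close>, so the bound is free of the
  maximiser \<open>x\<close>.\<close>

lemma phi_le:
  assumes "0 \<le> \<sigma>" "\<sigma> \<le> 1/2" "0 \<le> \<delta>" "\<delta> \<le> 1/2" "t > 0"
  shows "phi \<sigma> \<delta> \<le> log 2 ((1 - \<delta>) * (t\<^sup>2 + 1) + 2 * \<delta> * t) - 2 * (1 - \<sigma>) * log 2 t - 1"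
proof -
  define Z where "Z = (1 - \<delta>) * (t\<^sup>2 + 1) + 2 * \<delta> * t"
  have Z: "Z > 0" using assms unfolding Z_def by (intro add_pos_nonneg mult_pos_pos) (auto intro: add_nonneg_pos)
  obtain x where x: "x \<in> {0..\<sigma>}"
    "\<bar>alpha \<sigma> \<delta> x\<bar> \<noteq> \<infinity>" "(SUP y\<in>{0..\<sigma>}. alpha \<sigma> \<delta> y) = alpha \<sigma> \<delta> x"
    using alpha_max_attained[of \<sigma> \<delta>] assms by auto
  have x0: "\<delta> > 0 \<or> x = 0"
  proof (rule ccontr)
    assume "\<not> (\<delta> > 0 \<or> x = 0)"
    then have "\<delta> = 0" "x > 0" using assms x(1) by auto
    then show False using x(2) by (simp add: alpha_def elog2_def)
  qed
  define e00 e01 e11 where "e00 = ((1 - \<delta>) * t\<^sup>2 / Z - (1 - \<sigma> - x)) / ln 2"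
    and "e01 = (\<delta> * t / Z - x) / ln 2" and "e11 = ((1 - \<delta>) / Z - (\<sigma> - x)) / ln 2"
  note e_defs = e00_def e01_def e11_def
  have "x * log 2 (\<delta> * t) - x * log 2 x \<le> x * log 2 Z + e01"
    unfolding e_defs using x assms Z x0 by (intro gibbs_term_le) auto
  moreover have "x * log 2 (\<delta> * t) = x * log 2 \<delta> + x * log 2 t"
    using x0 assms by (auto simp: log_mult algebra_simps)
  ultimately have g01: "x * log 2 \<delta> + x * log 2 t - x * log 2 x \<le> x * log 2 Z + e01" by simp
  have "(1 - \<sigma> - x) * log 2 ((1 - \<delta>) * t\<^sup>2) - (1 - \<sigma> - x) * log 2 (1 - \<sigma> - x)
      \<le> (1 - \<sigma> - x) * log 2 Z + e00"
    unfolding e_defs using x assms Z x0 by (intro gibbs_term_le) auto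
  moreover have "log 2 ((1 - \<delta>) * t\<^sup>2) = log 2 (1 - \<delta>) + 2 * log 2 t"
    using assms by (simp add: log_mult log_nat_power)
  ultimately have g00: "(1 - \<sigma> - x) * (log 2 (1 - \<delta>) + 2 * log 2 t) - (1 - \<sigma> - x) * log 2 (1 - \<sigma> - x)
      \<le> (1 - \<sigma> - x) * log 2 Z + e00" by (simp only:)
  have g11: "(\<sigma> - x) * log 2 (1 - \<delta>) - (\<sigma> - x) * log 2 (\<sigma> - x) \<le> (\<sigma> - x) * log 2 Z + e11"
    unfolding e_defs using x assms Z x0 by (intro gibbs_term_le) auto
  \<comment> \<open>The off-diagonal cell counts twice.\<close>
  have "2 * e01 + e00 + e11 = ((2 * \<delta> * t + (1 - \<delta>) * t\<^sup>2 + (1 - \<delta>)) / Z - 1) / ln 2"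
    by (simp add: e_defs diff_divide_distrib add_divide_distrib)
  also have "2 * \<delta> * t + (1 - \<delta>) * t\<^sup>2 + (1 - \<delta>) = Z" by (simp add: Z_def algebra_simps)
  finally have e: "2 * e01 + e00 + e11 = 0" using Z by simp
  have "- 2 * (x * log 2 x) - (\<sigma> - x) * log 2 (\<sigma> - x)
     - (1 - \<sigma> - x) * log 2 (1 - \<sigma> - x)
     + 2 * x * log 2 \<delta> + (1 - 2 * x) * log 2 (1 - \<delta>) \<le> log 2 Z - 2 * (1 - \<sigma>) * log 2 t"
    using g00 g01 g11 e by (simp add: algebra_simps)
  moreover have "phi \<sigma> \<delta> = bin_entropy \<sigma> - 1 + (- 2 * (x * log 2 x) - (\<sigma> - x) * log 2 (\<sigma> - x)
     - (1 - \<sigma> - x) * log 2 (1 - \<sigma> - x) - bin_entropy \<sigma>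
     + 2 * x * log 2 \<delta> + (1 - 2 * x) * log 2 (1 - \<delta>))"
    unfolding phi_def x(3) using x assms x0 by (subst alpha_eq_joint_entropy) auto
  ultimately show ?thesis by (simp add: Z_def)
qed

text \<open>The equality case of Gibbs' inequality: when the normalised weights have marginals
  \<open>1 - \<sigma>\<close>, \<open>\<sigma>\<close>, the choice
  \<open>x = \<delta> * t / Z\<close> makes the joint law equal to them, and the supremum is at
  least the value there.\<close>

lemma phi_ge_tilted:
  assumes "0 \<le> \<sigma>" "\<sigma> \<le> 1/2" "0 \<le> \<delta>" "\<delta> \<le> 1/2" "t > 0"
    and \<sigma>t: "\<sigma> * ((1 - \<delta>) * (t\<^sup>2 + 1) + 2 * \<delta> * t) = \<delta> * t + (1 - \<delta>)"
  shows "log 2 ((1 - \<delta>) * (t\<^sup>2 + 1) + 2 * \<delta> * t) - 2 * (1 - \<sigma>) * log 2 t - 1 \<le> phi \<sigma> \<delta>"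
proof -
  define Z where "Z = (1 - \<delta>) * (t\<^sup>2 + 1) + 2 * \<delta> * t"
  have Z: "Z > 0" using assms unfolding Z_def by (intro add_pos_nonneg mult_pos_pos) (auto intro: add_nonneg_pos)
  define x where "x = \<delta> * t / Z"
  have p11: "\<sigma> - x = (1 - \<delta>) / Z" using \<sigma>t[folded Z_def] Z by (simp add: x_def field_simps)
  have "1 - \<sigma> - x = 1 - (1 - \<delta>) / Z - 2 * x" using p11 by simp
  also have "\<dots> = (Z - (1 - \<delta>) - 2 * \<delta> * t) / Z" using Z by (simp add: x_def field_simps)
  also have "Z - (1 - \<delta>) - 2 * \<delta> * t = (1 - \<delta>) * t\<^sup>2" by (simp add: Z_def algebra_simps)
  finally have p00: "1 - \<sigma> - x = (1 - \<delta>) * t\<^sup>2 / Z" .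
  have x: "0 \<le> x" "\<delta> > 0 \<or> x = 0" using assms Z by (auto simp: x_def)
  have "\<sigma> - x \<ge> 0" unfolding p11 using assms Z by simp
  then have x\<sigma>: "x \<le> \<sigma>" by simp
  have 1: "x * log 2 x = x * log 2 \<delta> + x * log 2 t - x * log 2 Z"
    using assms Z x by (cases "\<delta> = 0") (auto simp: x_def log_divide log_mult algebra_simps)
  have 2: "log 2 (\<sigma> - x) = log 2 (1 - \<delta>) - log 2 Z"
    using assms Z unfolding p11 by (simp add: log_divide)
  have 3: "log 2 (1 - \<sigma> - x) = log 2 (1 - \<delta>) + 2 * log 2 t - log 2 Z"
    using assms Z unfolding p00 by (simp add: log_divide log_mult log_nat_power)
  have "bin_entropy \<sigma> - 1 + (- 2 * (x * log 2 x) - (\<sigma> - x) * log 2 (\<sigma> - x)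
     - (1 - \<sigma> - x) * log 2 (1 - \<sigma> - x) - bin_entropy \<sigma>
     + 2 * x * log 2 \<delta> + (1 - 2 * x) * log 2 (1 - \<delta>)) \<le> phi \<sigma> \<delta>"
    using assms x x\<sigma> by (intro phi_ge[of x] alpha_eq_joint_entropy) auto
  then show ?thesis
    unfolding 1 2 3 Z_def[symmetric] by (simp add: algebra_simps)
qed

text \<open>The weights \<open>(1 - \<delta>) * t\<^sup>2\<close>, \<open>\<delta> * t\<close>, \<open>\<delta> * t\<close>, \<open>1 - \<delta>\<close> on pairs of bits are the noise kernel
  tilted by the function \<open>(t, 1)\<close>; \<open>t\<close> is chosen such that their normalised marginals are
  \<open>(1 - \<sigma>, \<sigma>)\<close>.\<close>

lemma tilting_exists:
  fixes \<sigma> \<delta> :: real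
  assumes "0 < \<sigma>" "\<sigma> \<le> 1/2" "0 \<le> \<delta>" "\<delta> \<le> 1/2"
  obtains t where "t \<ge> 1" "\<sigma> * ((1 - \<delta>) * (t\<^sup>2 + 1) + 2 * \<delta> * t) = \<delta> * t + (1 - \<delta>)"
proof -
  define P where "P = (\<lambda>t. \<sigma> * ((1 - \<delta>) * (t\<^sup>2 + 1) + 2 * \<delta> * t) - (\<delta> * t + (1 - \<delta>)))"
  \<comment> \<open>With \<open>\<sigma> * (1 - \<delta>) * T = 1 - \<sigma>\<close> the quadratic
    term of \<open>P T\<close> becomes linear and the rest splits into nonnegative summands. At the
    other end, \<open>P 1 = 2 * \<sigma> - 1\<close>.\<close>
  define T where "T = (1 - \<sigma>) / (\<sigma> * (1 - \<delta>))"
  have "\<sigma> * (1 - \<delta>) \<le> \<sigma> * 1" using assms by (intro mult_left_mono) auto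
  then have "\<sigma> * (1 - \<delta>) \<le> 1 - \<sigma>" using assms by linarith
  then have T: "T \<ge> 1" using assms by (simp add: T_def)
  have P1: "P 1 \<le> 0" using assms by (simp add: P_def algebra_simps)
  have "\<sigma> * (1 - \<delta>) * T = 1 - \<sigma>" using assms by (simp add: T_def)
  then have "\<sigma> * (1 - \<delta>) * T * T = (1 - \<sigma>) * T" by simp
  then have "P T = (1 - \<sigma>) * T + \<sigma> * \<delta> * T - (1 - \<sigma>) * (\<delta> * T + (1 - \<delta>))"
    by (simp add: P_def algebra_simps power2_eq_square)
  also have "\<dots> = (1 - \<sigma>) * (1 - \<delta>) * (T - 1) + \<sigma> * \<delta> * T" by (simp add: algebra_simps)
  also have "\<dots> \<ge> 0" using assms T by auto
  finally have PT: "P T \<ge> 0" .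
  have "\<exists>t\<ge>1. t \<le> T \<and> P t = 0"
    using P1 PT T by (intro IVT') (auto simp: P_def intro!: continuous_intros)
  then show ?thesis using that by (auto simp: P_def)
qed

section \<open>The two-point inequality\<close>

text \<open>The function \<open>(exp u, 1)\<close> on the two-point space is a critical point of
  \<open>\<parallel>T f\<parallel>\<^sub>2 / \<parallel>f\<parallel>\<^sub>r\<close> iff \<open>noise_slope \<delta> u = (r - 1) * u\<close>. Since \<open>noise_slope\<close> is concave on
  \<open>u \<ge> 0\<close>, the positive critical point is the maximum.\<close>

definition noise_slope :: "real \<Rightarrow> real \<Rightarrow> real" where
  "noise_slope \<delta> u = ln ((1 - \<delta>) * exp u + \<delta>) - ln (\<delta> * exp u + (1 - \<delta>))"

lemma noise_slope_0 [simp]: "noise_slope \<delta> 0 = 0"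
  by (simp add: noise_slope_def)

text \<open>Cancelling \<open>exp u\<close> leaves a denominator in \<open>cosh u\<close>, from
  which it is visible that the derivative decreases for \<open>u \<ge> 0\<close>.\<close>

lemma noise_slope_has_derivative:
  assumes "0 \<le> \<delta>" "\<delta> < 1/2"
  shows "(noise_slope \<delta> has_real_derivative
           (1 - 2 * \<delta>) / (2 * \<delta> * (1 - \<delta>) * cosh u + ((1 - \<delta>)\<^sup>2 + \<delta>\<^sup>2))) (at u)"
proof -
  have p: "(1 - \<delta>) * exp u + \<delta> > 0" "\<delta> * exp u + (1 - \<delta>) > 0"
    using assms by (auto intro: add_pos_nonneg add_nonneg_pos)
  have "(noise_slope \<delta> has_real_derivative
      ((1 - \<delta>) * exp u / ((1 - \<delta>) * exp u + \<delta>) - \<delta> * exp u / (\<delta> * exp u + (1 - \<delta>)))) (at u)"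
    unfolding noise_slope_def using p by (auto intro!: derivative_eq_intros simp: mult.commute)
  also have "(1 - \<delta>) * exp u / ((1 - \<delta>) * exp u + \<delta>) - \<delta> * exp u / (\<delta> * exp u + (1 - \<delta>))
      = (1 - 2 * \<delta>) * exp u / (((1 - \<delta>) * exp u + \<delta>) * (\<delta> * exp u + (1 - \<delta>)))"
    using p by (subst diff_frac_eq) (auto simp: algebra_simps)
  also have "((1 - \<delta>) * exp u + \<delta>) * (\<delta> * exp u + (1 - \<delta>))
      = exp u * (2 * \<delta> * (1 - \<delta>) * cosh u + ((1 - \<delta>)\<^sup>2 + \<delta>\<^sup>2))"
    by (simp add: cosh_def exp_minus field_simps power2_eq_square)
  also have "(1 - 2 * \<delta>) * exp u / (exp u * (2 * \<delta> * (1 - \<delta>) * cosh u + ((1 - \<delta>)\<^sup>2 + \<delta>\<^sup>2)))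
      = (1 - 2 * \<delta>) / (2 * \<delta> * (1 - \<delta>) * cosh u + ((1 - \<delta>)\<^sup>2 + \<delta>\<^sup>2))"
    by simp
  finally show ?thesis .
qed

lemma noise_slope_derivative_antimono:
  fixes \<delta> u v :: real
  assumes "0 \<le> \<delta>" "\<delta> < 1/2" "0 \<le> u" "u \<le> v"
  shows "(1 - 2 * \<delta>) / (2 * \<delta> * (1 - \<delta>) * cosh v + ((1 - \<delta>)\<^sup>2 + \<delta>\<^sup>2))
       \<le> (1 - 2 * \<delta>) / (2 * \<delta> * (1 - \<delta>) * cosh u + ((1 - \<delta>)\<^sup>2 + \<delta>\<^sup>2))"
proof -
  have "(1 - \<delta>)\<^sup>2 + \<delta>\<^sup>2 > 0" using assms by (intro add_pos_nonneg) auto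
  moreover have "0 \<le> 2 * \<delta> * (1 - \<delta>) * cosh w" for w
    using assms cosh_real_nonneg[of w] by auto
  moreover have "cosh u \<le> cosh v" using assms by (subst cosh_real_nonneg_le_iff) auto
  ultimately show ?thesis
    using assms by (intro divide_left_mono add_mono mult_left_mono mult_pos_pos) (auto intro: add_nonneg_pos)
qed

text \<open>A concave function vanishing at 0 has decreasing chord slopes
  \<open>noise_slope \<delta> u / u\<close>; the cross-multiplied form covers
  \<open>u = 0\<close>.\<close>

lemma noise_slope_chord:
  assumes "0 \<le> \<delta>" "\<delta> < 1/2" "0 \<le> u" "u \<le> v"
  shows "noise_slope \<delta> v * u \<le> noise_slope \<delta> u * v"
proof (cases "v = 0")
  case False
  then have v: "v > 0" using assms by simp
  have "convex_on {0..} (\<lambda>u. - noise_slope \<delta> u)"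
    by (rule convex_on_realI[where f' = "\<lambda>u. - ((1 - 2 * \<delta>) / (2 * \<delta> * (1 - \<delta>) * cosh u + ((1 - \<delta>)\<^sup>2 + \<delta>\<^sup>2)))"])
      (use assms in \<open>auto intro!: DERIV_minus noise_slope_has_derivative noise_slope_derivative_antimono\<close>)
  from convex_onD[OF this, of "u / v" 0 v]
  have "- noise_slope \<delta> u \<le> (u / v) * (- noise_slope \<delta> v)"
    using assms v by (simp add: divide_le_eq)
  then show ?thesis using v by (simp add: field_simps)
qed (use assms in auto)

text \<open>The upper bound is the tangent at 0. Its slope \<open>1 - 2 * \<delta>\<close> is
  \<open>p - 1\<close>, which keeps the critical exponent at most \<open>p\<close>.\<close>

lemma noise_slope_bounds:
  assumes "0 \<le> \<delta>" "\<delta> < 1/2" "0 \<le> u"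
  shows "0 \<le> noise_slope \<delta> u" "noise_slope \<delta> u \<le> (1 - 2 * \<delta>) * u"
proof -
  have "\<delta> * exp u + (1 - \<delta>) \<le> (1 - \<delta>) * exp u + \<delta>"
    using mult_left_mono[of 1 "exp u" "1 - 2 * \<delta>"] assms by (simp add: algebra_simps)
  moreover have "\<delta> * exp u + (1 - \<delta>) > 0"
    using assms by (auto intro: add_pos_nonneg add_nonneg_pos)
  ultimately show "0 \<le> noise_slope \<delta> u" by (simp add: noise_slope_def)
  define h where "h = (\<lambda>u. (1 - 2 * \<delta>) * u - noise_slope \<delta> u)"
  have "h 0 \<le> h u"
  proof (rule DERIV_nonneg_imp_nondecreasing[of 0 u h])
    fix x assume x: "0 \<le> x" "x \<le> u"
    have "(h has_real_derivative (1 - 2 * \<delta>) - (1 - 2 * \<delta>) / (2 * \<delta> * (1 - \<delta>) * cosh x + ((1 - \<delta>)\<^sup>2 + \<delta>\<^sup>2))) (at x)"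
      unfolding h_def by (auto intro!: derivative_eq_intros noise_slope_has_derivative assms)
    moreover have "(1 - 2 * \<delta>) / (2 * \<delta> * (1 - \<delta>) * cosh x + ((1 - \<delta>)\<^sup>2 + \<delta>\<^sup>2))
       \<le> (1 - 2 * \<delta>) / (2 * \<delta> * (1 - \<delta>) * cosh 0 + ((1 - \<delta>)\<^sup>2 + \<delta>\<^sup>2))"
      using assms x by (intro noise_slope_derivative_antimono) auto
    moreover have "2 * \<delta> * (1 - \<delta>) * cosh 0 + ((1 - \<delta>)\<^sup>2 + \<delta>\<^sup>2) = 1"
      by (simp add: algebra_simps power2_eq_square)
    ultimately show "\<exists>y. (h has_real_derivative y) (at x) \<and> 0 \<le> y" by fastforce
  qed (use assms in auto)
  then show "noise_slope \<delta> u \<le> (1 - 2 * \<delta>) * u" by (simp add: h_def)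
qed

text \<open>\<open>r - 1\<close> is the slope of the chord from 0 to \<open>v\<close>, so both sign
  conditions express that chord slopes decrease. For \<open>v = 0\<close> the tangent slope takes
  its place.\<close>

lemma critical_exponent:
  assumes "0 \<le> \<delta>" "\<delta> < 1/2" "0 \<le> v"
  obtains r where "1 \<le> r" "r \<le> 2 * (1 - \<delta>)" "noise_slope \<delta> v = (r - 1) * v"
    "\<And>u. 0 \<le> u \<Longrightarrow> u \<le> v \<Longrightarrow> (r - 1) * u \<le> noise_slope \<delta> u"
    "\<And>u. v \<le> u \<Longrightarrow> noise_slope \<delta> u \<le> (r - 1) * u"
proof (cases "v = 0")
  case True
  show ?thesis
    by (rule that[of "2 * (1 - \<delta>)"]) (use True assms noise_slope_bounds(2)[of \<delta>] in \<open>auto simp: algebra_simps\<close>)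
next
  case False
  then have v: "v > 0" using assms by simp
  define r where "r = 1 + noise_slope \<delta> v / v"
  show ?thesis
  proof (rule that[of r])
    show "1 \<le> r" "r \<le> 2 * (1 - \<delta>)" "noise_slope \<delta> v = (r - 1) * v"
      using noise_slope_bounds[OF assms] v by (auto simp: r_def divide_le_eq)
    show "(r - 1) * u \<le> noise_slope \<delta> u" if "0 \<le> u" "u \<le> v" for u
      using noise_slope_chord[of \<delta> u v] that assms v by (simp add: r_def field_simps)
    show "noise_slope \<delta> u \<le> (r - 1) * u" if "v \<le> u" for u
      using noise_slope_chord[of \<delta> v u] that assms v by (simp add: r_def field_simps)
  qed
qed

section \<open>The two-point inequality and its duality with \<open>phi\<close>\<close>

text \<open>\<open>F u\<close> is the logarithm of the squared ratio of the 2-norm after noise to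
  the \<open>r\<close>-norm before it, in unnormalised sums, at the function
  \<open>(exp u, 1)\<close>. Its derivative has the sign of
  \<open>noise_slope \<delta> u - (r - 1) * u\<close>, so \<open>F\<close> rises up to
  \<open>v\<close> and falls afterwards.\<close>

lemma two_point_log_max:
  assumes \<delta>: "0 \<le> \<delta>" "\<delta> < 1/2" and r: "1 \<le> r" and v: "0 \<le> v"
    and below: "\<And>u. 0 \<le> u \<Longrightarrow> u \<le> v \<Longrightarrow> (r - 1) * u \<le> noise_slope \<delta> u"
    and above: "\<And>u. v \<le> u \<Longrightarrow> noise_slope \<delta> u \<le> (r - 1) * u"
    and u: "0 \<le> u"
  defines "F \<equiv> \<lambda>u. ln ((1 - \<delta>) * ((exp u)\<^sup>2 + 1) + 2 * \<delta> * exp u) - 2 / r * ln (exp (r * u) + 1)"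
  shows "F u \<le> F v"
proof -
  define A where "A = (\<lambda>u. (1 - \<delta>) * exp u + \<delta>)"
  define B where "B = (\<lambda>u. \<delta> * exp u + (1 - \<delta>))"
  define Z where "Z = (\<lambda>u. (1 - \<delta>) * ((exp u)\<^sup>2 + 1) + 2 * \<delta> * exp u)"
  have pos: "A u > 0" "B u > 0" for u
    using \<delta> by (auto simp: A_def B_def intro: add_pos_nonneg add_nonneg_pos)
  have e1: "exp x + 1 \<noteq> (0::real)" for x
    using exp_gt_zero[of x] by linarith
  have ZAB: "Z u = exp u * A u + B u" for u
    by (simp add: A_def B_def Z_def power2_eq_square algebra_simps)
  have Zpos: "Z u > 0" for u using pos[of u] by (simp add: ZAB add_pos_pos)
  define D where "D = (\<lambda>u. 2 * (exp u * A u) / Z u - 2 * exp (r * u) / (exp (r * u) + 1))"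
  have deriv: "(F has_real_derivative D u) (at u)" for u
  proof -
    have "(F has_real_derivative ((1 - \<delta>) * (2 * exp u * exp u) + 2 * \<delta> * exp u) / Z u
             - 2 / r * (r * exp (r * u) / (exp (r * u) + 1))) (at u)"
      unfolding F_def Z_def[symmetric]
      using Zpos[of u, unfolded Z_def]
      by (auto intro!: derivative_eq_intros simp: Z_def add_pos_pos mult_ac)
    also have "(1 - \<delta>) * (2 * exp u * exp u) + 2 * \<delta> * exp u = 2 * (exp u * A u)"
      by (simp add: A_def algebra_simps)
    finally show ?thesis using r by (simp add: D_def)
  qed
  \<comment> \<open>Since \<open>Z u = exp u * A u + B u\<close>, the numerator compares
    \<open>A u / B u\<close>, which is \<open>exp (noise_slope \<delta> u)\<close>, with
    \<open>exp ((r - 1) * u)\<close>.\<close>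
  have D: "D u = 2 * (exp u * B u) * (exp (noise_slope \<delta> u) - exp ((r - 1) * u)) / (Z u * (exp (r * u) + 1))" for u
  proof -
    have "D u = (2 * (exp u * A u) * (exp (r * u) + 1) - 2 * exp (r * u) * Z u) / (Z u * (exp (r * u) + 1))"
      unfolding D_def using Zpos[of u] by (subst diff_frac_eq) (auto simp: e1 mult_ac)
    also have "2 * (exp u * A u) * (exp (r * u) + 1) - 2 * exp (r * u) * Z u
        = 2 * (exp u * A u - exp (r * u) * B u)"
      by (simp add: ZAB algebra_simps)
    also have "exp (r * u) = exp u * exp ((r - 1) * u)"
      by (simp add: algebra_simps flip: exp_add)
    also have "exp u * A u - exp u * exp ((r - 1) * u) * B u = exp u * B u * (A u / B u - exp ((r - 1) * u))"
      using pos[of u] by (simp add: field_simps)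
    also have "A u / B u = exp (noise_slope \<delta> u)"
      using pos[of u] by (simp add: noise_slope_def exp_diff A_def B_def)
    also have "exp u * exp ((r - 1) * u) = exp (r * u)"
      by (simp add: algebra_simps flip: exp_add)
    finally show ?thesis by (simp add: mult_ac)
  qed
  show ?thesis
  proof (cases "u \<le> v")
    case True
    show ?thesis
    proof (rule DERIV_nonneg_imp_nondecreasing[of u v F])
      fix x assume "u \<le> x" "x \<le> v"
      then have "D x \<ge> 0" using below[of x] u pos[of x] Zpos[of x] unfolding D
        by (intro divide_nonneg_nonneg mult_nonneg_nonneg) (auto simp: less_imp_le add_pos_pos)
      then show "\<exists>y. (F has_real_derivative y) (at x) \<and> 0 \<le> y" using deriv by blast
    qed (rule True)
  next
    case False
    show ?thesis
    proof (rule DERIV_nonpos_imp_nonincreasing[of v u F])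
      fix x assume "v \<le> x" "x \<le> u"
      then have "D x \<le> 0" using above[of x] u pos[of x] Zpos[of x] unfolding D
        by (intro divide_nonpos_nonneg mult_nonneg_nonpos) (auto simp: less_imp_le add_pos_pos)
      then show "\<exists>y. (F has_real_derivative y) (at x) \<and> y \<le> 0" using deriv by blast
    qed (use False in auto)
  qed
qed

text \<open>With \<open>\<delta> = 2 * \<epsilon> * (1 - \<epsilon>)\<close> the left side is the
  sum of squares of the noised function with values \<open>a\<close>, \<open>b\<close>, and
  \<open>c\<close> is the quotient at \<open>(t, 1)\<close>. Symmetry and homogeneity reduce to
  \<open>(s, 1)\<close> with \<open>s \<ge> 1\<close>; a single zero value is reached as a
  limit.\<close>

lemma two_point_bound:
  assumes \<delta>: "0 \<le> \<delta>" "\<delta> < 1/2" and r: "1 \<le> r" and t: "1 \<le> t"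
    and below: "\<And>u. 0 \<le> u \<Longrightarrow> u \<le> ln t \<Longrightarrow> (r - 1) * u \<le> noise_slope \<delta> u"
    and above: "\<And>u. ln t \<le> u \<Longrightarrow> noise_slope \<delta> u \<le> (r - 1) * u"
    and ab: "0 \<le> a" "0 \<le> b"
  defines "c \<equiv> ((1 - \<delta>) * (t\<^sup>2 + 1) + 2 * \<delta> * t) / (t powr r + 1) powr (2 / r)"
  shows "(1 - \<delta>) * (a\<^sup>2 + b\<^sup>2) + 2 * \<delta> * a * b \<le> c * (a powr r + b powr r) powr (2 / r)"
proof -
  have Zpos: "(1 - \<delta>) * (s\<^sup>2 + 1) + 2 * \<delta> * s > 0" if "s \<ge> 0" for s :: real
    using \<delta> that by (intro add_pos_nonneg mult_pos_pos add_nonneg_pos) auto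
  have normalized: "(1 - \<delta>) * (s\<^sup>2 + 1) + 2 * \<delta> * s \<le> c * (s powr r + 1) powr (2 / r)" if s: "s \<ge> 1" for s
  proof -
    have F: "ln ((1 - \<delta>) * ((exp (ln s))\<^sup>2 + 1) + 2 * \<delta> * exp (ln s)) - 2 / r * ln (exp (r * ln s) + 1)
      \<le> ln ((1 - \<delta>) * ((exp (ln t))\<^sup>2 + 1) + 2 * \<delta> * exp (ln t)) - 2 / r * ln (exp (r * ln t) + 1)"
      using s t by (intro two_point_log_max \<delta> r below above) auto
    have E: "exp (2 / r * ln (exp (r * ln w) + 1)) = (w powr r + 1) powr (2 / r)" if "w \<ge> 1" for w
      using that add_pos_pos[of "exp (r * ln w)" 1] by (simp add: powr_def)
    have "exp (ln ((1 - \<delta>) * (s\<^sup>2 + 1) + 2 * \<delta> * s) - 2 / r * ln (exp (r * ln s) + 1))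
      \<le> exp (ln ((1 - \<delta>) * (t\<^sup>2 + 1) + 2 * \<delta> * t) - 2 / r * ln (exp (r * ln t) + 1))"
      using F s t by simp
    then have "((1 - \<delta>) * (s\<^sup>2 + 1) + 2 * \<delta> * s) / (s powr r + 1) powr (2 / r) \<le> c"
      unfolding exp_diff E[OF s] E[OF t] using s t Zpos[of s] Zpos[of t] by (simp add: c_def)
    moreover have "s powr r + 1 > 0" by (intro add_nonneg_pos) auto
    ultimately show ?thesis by (simp add: field_simps)
  qed
  have positive: "(1 - \<delta>) * (a\<^sup>2 + b\<^sup>2) + 2 * \<delta> * a * b \<le> c * (a powr r + b powr r) powr (2 / r)"
    if "0 < b" "b \<le> a" for a b
  proof -
    have "(1 - \<delta>) * (a\<^sup>2 + b\<^sup>2) + 2 * \<delta> * a * b = b\<^sup>2 * ((1 - \<delta>) * ((a / b)\<^sup>2 + 1) + 2 * \<delta> * (a / b))"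
      using that by (simp add: field_simps power2_eq_square)
    also have "\<dots> \<le> b\<^sup>2 * (c * ((a / b) powr r + 1) powr (2 / r))"
      using that by (intro mult_left_mono normalized) auto
    also have "\<dots> = (b powr r) powr (2 / r) * (c * ((a / b) powr r + 1) powr (2 / r))"
      using that r by (simp add: powr_powr)
    also have "\<dots> = c * (b powr r * ((a / b) powr r + 1)) powr (2 / r)"
      by (subst powr_mult) auto
    also have "b powr r * ((a / b) powr r + 1) = a powr r + b powr r"
      using that by (simp add: powr_divide field_simps)
    finally show ?thesis .
  qed
  have ordered: "(1 - \<delta>) * (a\<^sup>2 + b\<^sup>2) + 2 * \<delta> * a * b \<le> c * (a powr r + b powr r) powr (2 / r)"
    if "0 \<le> b" "b \<le> a" "0 < a" for a b
  proof (cases "b = 0")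
    case False
    then show ?thesis using that positive by simp
  next
    case True
    have r0: "r > 0" "2 / r > 0" using r by auto
    have l1: "((\<lambda>b. (1 - \<delta>) * (a\<^sup>2 + b\<^sup>2) + 2 * \<delta> * a * b) \<longlongrightarrow> (1 - \<delta>) * (a\<^sup>2 + 0\<^sup>2) + 2 * \<delta> * a * 0) (at_right 0)"
      by (intro tendsto_intros)
    have "eventually (\<lambda>b. 0 \<le> b) (at_right (0::real))"
      by (auto simp: eventually_at_filter)
    then have "((\<lambda>b. b powr r) \<longlongrightarrow> 0 powr r) (at_right (0::real))"
      using r0 by (intro tendsto_powr' tendsto_intros) auto
    then have l2: "((\<lambda>b. c * (a powr r + b powr r) powr (2 / r)) \<longlongrightarrow> c * (a powr r + 0 powr r) powr (2 / r)) (at_right 0)"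
      using that by (intro tendsto_mult_left tendsto_powr[OF tendsto_add[OF tendsto_const] tendsto_const]) auto
    have "eventually (\<lambda>b. (1 - \<delta>) * (a\<^sup>2 + b\<^sup>2) + 2 * \<delta> * a * b \<le> c * (a powr r + b powr r) powr (2 / r)) (at_right 0)"
      using that positive unfolding eventually_at_right_field by (intro exI[of _ a]) auto
    from tendsto_le[OF _ l2 l1 this] show ?thesis using True by simp
  qed
  show ?thesis
  proof (cases "a = 0 \<and> b = 0")
    case False
    then show ?thesis
      using ordered[of a b] ordered[of b a] ab by (cases "b \<le> a") (auto simp: add.commute mult_ac)
  qed (use r in auto)
qed

text \<open>One half of the Legendre duality: tilting for \<open>\<sigma>\<close> fixes
  \<open>t\<close>, criticality at \<open>ln t\<close> fixes \<open>r\<close>, and \<open>c\<close>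
  is the two-point constant for this pair.\<close>

lemma two_point_bound_phi:
  assumes "0 \<le> \<sigma>" "\<sigma> \<le> 1/2" "0 \<le> \<delta>" "\<delta> < 1/2"
  obtains r c where "1 \<le> r" "r \<le> 2 * (1 - \<delta>)" "0 < c"
    "\<And>a b. 0 \<le> a \<Longrightarrow> 0 \<le> b \<Longrightarrow>
       (1 - \<delta>) * (a\<^sup>2 + b\<^sup>2) + 2 * \<delta> * a * b \<le> c * (a powr r + b powr r) powr (2 / r)"
    "log 2 c - 1 + 2 / r * bin_entropy \<sigma> \<le> phi \<sigma> \<delta>"
proof (cases "\<sigma> = 0")
  case True
  show ?thesis
  \<comment> \<open>No \<open>t\<close> solves the tilting equation for \<open>\<sigma> = 0\<close>.
    Here \<open>r = 1\<close> works: the entropy term vanishes, and the value of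
    \<open>alpha\<close> at \<open>x = 0\<close> is \<open>log 2 (1 - \<delta>)\<close>.\<close>
  proof (rule that[of 1 "1 - \<delta>"])
    fix a b :: real assume ab: "0 \<le> a" "0 \<le> b"
    have "\<delta> * (a * b) \<le> (1 - \<delta>) * (a * b)" using assms ab by (intro mult_right_mono) auto
    then show "(1 - \<delta>) * (a\<^sup>2 + b\<^sup>2) + 2 * \<delta> * a * b \<le> (1 - \<delta>) * (a powr 1 + b powr 1) powr (2 / 1)"
      using ab by (simp add: power2_eq_square algebra_simps)
  next
    have "bin_entropy \<sigma> - 1 + log 2 (1 - \<delta>) \<le> phi \<sigma> \<delta>"
      using assms by (intro phi_ge[of 0] alpha_0) auto
    then show "log 2 (1 - \<delta>) - 1 + 2 / 1 * bin_entropy \<sigma> \<le> phi \<sigma> \<delta>"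
      using True by (simp add: bin_entropy_def)
  qed (use assms in auto)
next
  case False
  then have \<sigma>: "\<sigma> > 0" using assms by simp
  obtain t where t: "t \<ge> 1" and \<sigma>t: "\<sigma> * ((1 - \<delta>) * (t\<^sup>2 + 1) + 2 * \<delta> * t) = \<delta> * t + (1 - \<delta>)"
    using tilting_exists[of \<sigma> \<delta>] \<sigma> assms by auto
  define Z where "Z = (1 - \<delta>) * (t\<^sup>2 + 1) + 2 * \<delta> * t"
  have Z: "Z > 0" using assms t unfolding Z_def by (intro add_pos_nonneg mult_pos_pos) (auto intro: add_nonneg_pos)
  have lt: "0 \<le> ln t" using t by simp
  obtain r where r: "1 \<le> r" "r \<le> 2 * (1 - \<delta>)" and crit: "noise_slope \<delta> (ln t) = (r - 1) * ln t"
    and r2: "\<And>u. 0 \<le> u \<Longrightarrow> u \<le> ln t \<Longrightarrow> (r - 1) * u \<le> noise_slope \<delta> u"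
    "\<And>u. ln t \<le> u \<Longrightarrow> noise_slope \<delta> u \<le> (r - 1) * u"
    using critical_exponent[OF assms(3,4) lt] by metis
  have B: "\<delta> * t + (1 - \<delta>) > 0" "(1 - \<delta>) * t + \<delta> > 0"
    using assms t by (auto intro: add_nonneg_pos add_pos_nonneg)
  \<comment> \<open>Criticality, exponentiated. The tilting equation then turns
    \<open>t powr r\<close> into \<open>(Z - \<sigma> * Z) / (\<sigma> * Z)\<close>, the odds
    belonging to \<open>\<sigma>\<close>.\<close>
  have "t powr (r - 1) = exp (noise_slope \<delta> (ln t))"
    using t crit by (simp add: powr_def)
  also have "\<dots> = ((1 - \<delta>) * t + \<delta>) / (\<delta> * t + (1 - \<delta>))"
    using t B by (simp add: noise_slope_def exp_diff)
  finally have "t powr r = t * (((1 - \<delta>) * t + \<delta>) / (\<delta> * t + (1 - \<delta>)))"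
    using t by (simp add: powr_diff field_simps)
  also have "\<dots> = (Z - (\<delta> * t + (1 - \<delta>))) / (\<delta> * t + (1 - \<delta>))"
    by (simp add: Z_def algebra_simps power2_eq_square)
  also have "\<dots> = (1 - \<sigma>) / \<sigma>"
    using Z \<sigma> unfolding \<sigma>t[symmetric] Z_def[symmetric] by (simp add: field_simps)
  finally have tr: "t powr r = (1 - \<sigma>) / \<sigma>" .
  have "log 2 (t powr r) = log 2 (1 - \<sigma>) - log 2 \<sigma>"
    unfolding tr using \<sigma> assms by (simp add: log_divide)
  then have l1: "log 2 (1 - \<sigma>) = log 2 \<sigma> + r * log 2 t" using t by (simp add: log_powr)
  have H: "bin_entropy \<sigma> = - log 2 \<sigma> - (1 - \<sigma>) * r * log 2 t"
    unfolding bin_entropy_def l1 by (simp add: algebra_simps)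
  define c where "c = Z / (t powr r + 1) powr (2 / r)"
  \<comment> \<open>Hence \<open>log 2 c\<close> contains \<open>2 / r * log 2 \<sigma>\<close>,
    which cancels against the same term of \<open>2 / r * bin_entropy \<sigma>\<close>.\<close>
  have tr1: "t powr r + 1 = 1 / \<sigma>" unfolding tr using \<sigma> by (simp add: field_simps)
  have c: "c > 0" unfolding c_def tr1 using Z \<sigma> by simp
  have lc: "log 2 c = log 2 Z + 2 / r * log 2 \<sigma>"
    unfolding c_def tr1 using Z \<sigma> by (simp add: log_divide log_powr)
  show ?thesis
  proof (rule that[OF r c])
    show "(1 - \<delta>) * (a\<^sup>2 + b\<^sup>2) + 2 * \<delta> * a * b \<le> c * (a powr r + b powr r) powr (2 / r)"
      if "0 \<le> a" "0 \<le> b" for a b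
      unfolding c_def Z_def by (rule two_point_bound) (use assms r r2 t that in auto)
    have "log 2 c - 1 + 2 / r * bin_entropy \<sigma> = log 2 Z - 2 * (1 - \<sigma>) * log 2 t - 1"
      unfolding lc H using r by (simp add: field_simps)
    also have "\<dots> \<le> phi \<sigma> \<delta>"
      unfolding Z_def by (rule phi_ge_tilted) (use assms t \<sigma>t in auto)
    finally show "log 2 c - 1 + 2 / r * bin_entropy \<sigma> \<le> phi \<sigma> \<delta>" .
  qed
qed

section \<open>Power sums\<close>

text \<open>Hoelder's inequality, from Young's inequality applied pointwise after both sums are
  normalised to 1. The weights satisfy \<open>\<alpha> + \<beta> = 1\<close> and
  \<open>\<alpha> + p * \<beta> = r\<close>.\<close>

lemma sum_powr_interpolation:
  fixes f :: "'a \<Rightarrow> real"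
  assumes "finite A" "1 \<le> r" "r \<le> p" "1 < p" "\<And>x. x \<in> A \<Longrightarrow> 0 \<le> f x"
  shows "(\<Sum>x\<in>A. f x powr r)
    \<le> (\<Sum>x\<in>A. f x) powr ((p - r) / (p - 1)) * (\<Sum>x\<in>A. f x powr p) powr ((r - 1) / (p - 1))"
proof (cases "\<exists>x\<in>A. f x \<noteq> 0")
  case False
  then show ?thesis using assms by simp
next
  case True
  then obtain x0 where x0: "x0 \<in> A" "f x0 > 0" using assms by force
  define S where "S = (\<Sum>x\<in>A. f x)"
  define P where "P = (\<Sum>x\<in>A. f x powr p)"
  have S: "S > 0" unfolding S_def using assms x0 by (intro sum_pos2[of _ x0]) auto
  have P: "P > 0" unfolding P_def using assms x0 by (intro sum_pos2[of _ x0]) auto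
  define \<alpha> where "\<alpha> = (p - r) / (p - 1)"
  define \<beta> where "\<beta> = (r - 1) / (p - 1)"
  have \<alpha>\<beta>: "0 \<le> \<alpha>" "0 \<le> \<beta>" "\<alpha> + \<beta> = 1"
    using assms by (auto simp: \<alpha>_def \<beta>_def simp flip: add_divide_distrib)
  have "\<alpha> + p * \<beta> = ((p - r) + p * (r - 1)) / (p - 1)" by (simp add: \<alpha>_def \<beta>_def add_divide_distrib)
  also have "(p - r) + p * (r - 1) = r * (p - 1)" by (simp add: algebra_simps)
  finally have rr: "\<alpha> + p * \<beta> = r" using assms by simp
  have pt: "f x powr r / (S powr \<alpha> * P powr \<beta>) \<le> \<alpha> * (f x / S) + \<beta> * (f x powr p / P)" if "x \<in> A" for x
  proof (cases "f x = 0")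
    case False
    then have fx: "f x > 0" using assms(5)[OF that] by simp
    have "(f x / S) powr \<alpha> * (f x powr p / P) powr \<beta> \<le> \<alpha> * (f x / S) + \<beta> * (f x powr p / P)"
      using fx S P \<alpha>\<beta> by (intro Youngs_inequality_0) auto
    also have "(f x / S) powr \<alpha> * (f x powr p / P) powr \<beta> = f x powr (\<alpha> + p * \<beta>) / (S powr \<alpha> * P powr \<beta>)"
      using fx S P by (simp add: powr_divide powr_powr powr_add)
    finally show ?thesis by (simp add: rr)
  qed simp
  have "(\<Sum>x\<in>A. f x powr r / (S powr \<alpha> * P powr \<beta>)) \<le> (\<Sum>x\<in>A. \<alpha> * (f x / S) + \<beta> * (f x powr p / P))"
    by (rule sum_mono) (rule pt)
  also have "\<dots> = \<alpha> * (S / S) + \<beta> * (P / P)"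
    by (simp only: sum.distrib S_def P_def sum_distrib_left[symmetric] sum_divide_distrib[symmetric])
  also have "\<dots> = 1" using S P \<alpha>\<beta> by simp
  finally have "(\<Sum>x\<in>A. f x powr r) / (S powr \<alpha> * P powr \<beta>) \<le> 1"
    by (simp add: sum_divide_distrib)
  then show ?thesis using S P by (simp add: \<alpha>_def \<beta>_def S_def P_def divide_le_eq)
qed

text \<open>Young's inequality against the uniform weights \<open>1 / card A\<close>. On the cube
  this says \<open>r(p) \<ge> 0\<close>.\<close>

lemma sum_le_powr_mean:
  fixes f :: "'a \<Rightarrow> real"
  assumes "finite A" "1 < p" "\<And>x. x \<in> A \<Longrightarrow> 0 \<le> f x" "\<exists>x\<in>A. f x \<noteq> 0"
  shows "(\<Sum>x\<in>A. f x) \<le> (\<Sum>x\<in>A. f x powr p) powr (1 / p) * real (card A) powr (1 - 1 / p)"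
proof -
  obtain x0 where x0: "x0 \<in> A" "f x0 > 0" using assms by force
  define P where "P = (\<Sum>x\<in>A. f x powr p)"
  define N where "N = real (card A)"
  have P: "P > 0" unfolding P_def using assms x0 by (intro sum_pos2[of _ x0]) auto
  have N: "N > 0" unfolding N_def using assms x0 by (auto simp: card_gt_0_iff)
  have pt: "f x / (P powr (1 / p) * N powr (1 - 1 / p)) \<le> 1 / p * (f x powr p / P) + (1 - 1 / p) * (1 / N)" if "x \<in> A" for x
  proof (cases "f x = 0")
    case True
    then show ?thesis using assms N by simp
  next
    case False
    then have fx: "f x > 0" using assms(3)[OF that] by simp
    have "(f x powr p / P) powr (1 / p) * (1 / N) powr (1 - 1 / p) \<le> 1 / p * (f x powr p / P) + (1 - 1 / p) * (1 / N)"
      using fx P N assms by (intro Youngs_inequality_0) auto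
    also have "(f x powr p / P) powr (1 / p) * (1 / N) powr (1 - 1 / p) = f x / (P powr (1 / p) * N powr (1 - 1 / p))"
      using fx P N assms by (simp add: powr_divide powr_powr)
    finally show ?thesis .
  qed
  have "(\<Sum>x\<in>A. f x / (P powr (1 / p) * N powr (1 - 1 / p))) \<le> (\<Sum>x\<in>A. 1 / p * (f x powr p / P) + (1 - 1 / p) * (1 / N))"
    by (rule sum_mono) (rule pt)
  also have "\<dots> = 1 / p * (P / P) + (1 - 1 / p) * (N * 1 / N)"
    by (simp only: sum.distrib P_def N_def sum_distrib_left[symmetric] sum_divide_distrib[symmetric] sum_constant)
  also have "\<dots> = 1" using P N by simp
  finally have "(\<Sum>x\<in>A. f x) / (P powr (1 / p) * N powr (1 - 1 / p)) \<le> 1"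
    by (simp add: sum_divide_distrib)
  then show ?thesis using P N by (simp add: P_def N_def divide_le_eq)
qed

text \<open>Each value is at most the total, so \<open>p - 1\<close> of its powers may be replaced
  by those of the total. On the cube this gives \<open>r(p) \<le> (p - 1) / p\<close>.\<close>

lemma sum_powr_le_powr_sum:
  fixes f :: "'a \<Rightarrow> real"
  assumes "finite A" "1 \<le> p" "\<And>x. x \<in> A \<Longrightarrow> 0 \<le> f x"
  shows "(\<Sum>x\<in>A. f x powr p) \<le> (\<Sum>x\<in>A. f x) powr p"
proof -
  have powr: "w powr p = w * w powr (p - 1)" if "w \<ge> 0" for w :: real
    using powr_mult_base[OF that, of "p - 1"] by simp
  have "(\<Sum>x\<in>A. f x powr p) \<le> (\<Sum>x\<in>A. f x * (\<Sum>x\<in>A. f x) powr (p - 1))"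
  proof (rule sum_mono)
    fix x assume x: "x \<in> A"
    have "f x \<le> (\<Sum>x\<in>A. f x)" using assms x by (intro member_le_sum) auto
    then show "f x powr p \<le> f x * (\<Sum>x\<in>A. f x) powr (p - 1)"
      using assms x by (simp add: powr) (intro mult_left_mono powr_mono2, auto)
  qed
  also have "\<dots> = (\<Sum>x\<in>A. f x) powr p"
    using assms by (simp add: sum_distrib_right[symmetric] powr sum_nonneg)
  finally show ?thesis .
qed

section \<open>The noise operator on the cube\<close>

lemma finite_cube [simp]: "finite (cube n)"
  using finite_lists_length_eq[of "UNIV :: bool set" n] by (simp add: cube_def)

lemma cube_0 [simp]: "cube 0 = {[]}"
  by (auto simp: cube_def)

lemma card_cube: "card (cube n) = 2 ^ n"
  using card_lists_length_eq[of "UNIV :: bool set" n] by (simp add: cube_def)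

lemma sum_cube_Suc:
  "(\<Sum>x\<in>cube (Suc n). F x) = (\<Sum>x\<in>cube n. F (True # x)) + (\<Sum>x\<in>cube n. F (False # x))"
proof -
  have "cube (Suc n) = (#) True ` cube n \<union> (#) False ` cube n"
    by (auto simp: cube_def length_Suc_conv image_iff)
  then have "(\<Sum>x\<in>cube (Suc n). F x) = sum F ((#) True ` cube n) + sum F ((#) False ` cube n)"
    by (simp only:) (rule sum.union_disjoint, auto)
  then show ?thesis by (simp add: sum.reindex)
qed

lemma hdist_Cons: "hdist (a # x) (b # y) = (if a = b then 0 else 1) + hdist x y"
proof -
  have "{i. i < length (a # x) \<and> (a # x) ! i \<noteq> (b # y) ! i}
      = (if a = b then {} else {0}) \<union> Suc ` {i. i < length x \<and> x ! i \<noteq> y ! i}" (is "?L = ?R")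
  proof (rule set_eqI)
    show "i \<in> ?L \<longleftrightarrow> i \<in> ?R" for i by (cases i) auto
  qed
  then show ?thesis
    unfolding hdist_def by (simp only:) (subst card_Un_disjoint, auto simp: card_image)
qed

lemma hdist_le: "x \<in> cube n \<Longrightarrow> hdist x y \<le> n"
  unfolding hdist_def cube_def
  by (rule order.trans[OF card_mono[of "{..<n}"]]) auto

section \<open>The noise kernel and its product structure\<close>

definition noise_kernel :: "nat \<Rightarrow> real \<Rightarrow> bool list \<Rightarrow> bool list \<Rightarrow> real" where
  "noise_kernel n \<epsilon> x y = \<epsilon> ^ hdist x y * (1 - \<epsilon>) ^ (n - hdist x y)"

lemma noise_kernel_Cons:
  "x \<in> cube n \<Longrightarrow>
     noise_kernel (Suc n) \<epsilon> (a # x) (b # y) = (if a = b then 1 - \<epsilon> else \<epsilon>) * noise_kernel n \<epsilon> x y"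
  using hdist_le[of x n y] by (auto simp: noise_kernel_def hdist_Cons Suc_diff_le)

lemma noise_conv_kernel: "noise n \<epsilon> f x = (\<Sum>y\<in>cube n. noise_kernel n \<epsilon> y x * f y)"
  by (simp add: noise_def noise_kernel_def)

lemma noise_kernel_nonneg: "0 \<le> \<epsilon> \<Longrightarrow> \<epsilon> \<le> 1 \<Longrightarrow> 0 \<le> noise_kernel n \<epsilon> x y"
  by (simp add: noise_kernel_def)

lemma noise_Cons:
  "noise (Suc n) \<epsilon> f (a # x)
     = (1 - \<epsilon>) * noise n \<epsilon> (\<lambda>y. f (a # y)) x + \<epsilon> * noise n \<epsilon> (\<lambda>y. f ((\<not> a) # y)) x"
proof -
  have "noise (Suc n) \<epsilon> f (a # x)
    = (\<Sum>y\<in>cube n. (if a then 1 - \<epsilon> else \<epsilon>) * noise_kernel n \<epsilon> y x * f (True # y))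
    + (\<Sum>y\<in>cube n. (if a then \<epsilon> else 1 - \<epsilon>) * noise_kernel n \<epsilon> y x * f (False # y))"
    unfolding noise_conv_kernel sum_cube_Suc
    by (intro arg_cong2[of _ _ _ _ "(+)"] sum.cong) (auto simp: noise_kernel_Cons)
  then show ?thesis
    by (cases a) (simp_all add: noise_conv_kernel sum_distrib_left mult_ac)
qed

text \<open>Two independent noises of rate \<open>\<epsilon>\<close>, composed, flip each bit with
  probability \<open>2 * \<epsilon> * (1 - \<epsilon>)\<close>; the sum factors over the
  bits.\<close>

lemma noise_kernel_semigroup:
  assumes "y \<in> cube n" "z \<in> cube n"
  shows "(\<Sum>x\<in>cube n. noise_kernel n \<epsilon> y x * noise_kernel n \<epsilon> z x)
           = noise_kernel n (2 * \<epsilon> * (1 - \<epsilon>)) y z"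
  using assms
proof (induction n arbitrary: y z)
  case 0
  then show ?case by (simp add: noise_kernel_def hdist_def)
next
  case (Suc n)
  obtain a y' b z' where yz: "y = a # y'" "z = b # z'" "y' \<in> cube n" "z' \<in> cube n"
    using Suc.prems by (auto simp: cube_def length_Suc_conv)
  define \<kappa> where "\<kappa> = (\<lambda>a b :: bool. if a = b then 1 - \<epsilon> else \<epsilon>)"
  have K: "noise_kernel (Suc n) \<epsilon> y (d # x) = \<kappa> a d * noise_kernel n \<epsilon> y' x"
    "noise_kernel (Suc n) \<epsilon> z (d # x) = \<kappa> b d * noise_kernel n \<epsilon> z' x" for d x
    using yz by (simp_all add: noise_kernel_Cons \<kappa>_def)
  have "(\<Sum>x\<in>cube (Suc n). noise_kernel (Suc n) \<epsilon> y x * noise_kernel (Suc n) \<epsilon> z x)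
      = (\<kappa> a True * \<kappa> b True + \<kappa> a False * \<kappa> b False)
        * (\<Sum>x\<in>cube n. noise_kernel n \<epsilon> y' x * noise_kernel n \<epsilon> z' x)"
    by (simp add: sum_cube_Suc K sum_distrib_left sum.distrib algebra_simps)
  also have "\<dots> = (\<kappa> a True * \<kappa> b True + \<kappa> a False * \<kappa> b False) * noise_kernel n (2 * \<epsilon> * (1 - \<epsilon>)) y' z'"
    using Suc.IH[OF yz(3,4)] by simp
  also have "\<kappa> a True * \<kappa> b True + \<kappa> a False * \<kappa> b False
      = (if a = b then 1 - 2 * \<epsilon> * (1 - \<epsilon>) else 2 * \<epsilon> * (1 - \<epsilon>))"
    by (auto simp: \<kappa>_def algebra_simps)
  finally show ?case using yz by (simp add: noise_kernel_Cons)
qed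

lemma sum_noise_squared:
  "(\<Sum>x\<in>cube n. (noise n \<epsilon> f x)\<^sup>2)
     = (\<Sum>y\<in>cube n. \<Sum>z\<in>cube n. noise_kernel n (2 * \<epsilon> * (1 - \<epsilon>)) y z * f y * f z)"
proof -
  have "(\<Sum>x\<in>cube n. (noise n \<epsilon> f x)\<^sup>2)
      = (\<Sum>x\<in>cube n. \<Sum>y\<in>cube n. \<Sum>z\<in>cube n. noise_kernel n \<epsilon> y x * noise_kernel n \<epsilon> z x * (f y * f z))"
    by (simp add: noise_conv_kernel power2_eq_square sum_product mult_ac)
  also have "\<dots> = (\<Sum>y\<in>cube n. \<Sum>z\<in>cube n. \<Sum>x\<in>cube n. noise_kernel n \<epsilon> y x * noise_kernel n \<epsilon> z x * (f y * f z))"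
    by (subst sum.swap, rule sum.cong[OF refl], rule sum.swap)
  also have "\<dots> = (\<Sum>y\<in>cube n. \<Sum>z\<in>cube n. noise_kernel n (2 * \<epsilon> * (1 - \<epsilon>)) y z * f y * f z)"
  proof (intro sum.cong refl)
    fix y z assume "y \<in> cube n" "z \<in> cube n"
    then show "(\<Sum>x\<in>cube n. noise_kernel n \<epsilon> y x * noise_kernel n \<epsilon> z x * (f y * f z))
        = noise_kernel n (2 * \<epsilon> * (1 - \<epsilon>)) y z * f y * f z"
      unfolding sum_distrib_right[symmetric] by (subst noise_kernel_semigroup) auto
  qed
  finally show ?thesis .
qed

text \<open>Induction on the number of bits. After splitting by the first bit, Cauchy-Schwarz bounds
  the cross term of the two noised restrictions by the product of their 2-norms, and induction
  bounds these by \<open>A True\<close> and \<open>A False\<close>. The two-point inequality for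
  that pair finishes the step.\<close>

lemma noise_tensorization:
  fixes c r \<epsilon> :: real
  defines "\<delta> \<equiv> 2 * \<epsilon> * (1 - \<epsilon>)"
  assumes r: "1 \<le> r" and c: "0 < c" and \<epsilon>: "0 \<le> \<epsilon>" "\<epsilon> \<le> 1"
    and two_point: "\<And>a b. 0 \<le> a \<Longrightarrow> 0 \<le> b \<Longrightarrow>
       (1 - \<delta>) * (a\<^sup>2 + b\<^sup>2) + 2 * \<delta> * a * b \<le> c * (a powr r + b powr r) powr (2 / r)"
    and f: "\<And>x. 0 \<le> f x"
  shows "(\<Sum>x\<in>cube n. (noise n \<epsilon> f x)\<^sup>2) \<le> c ^ n * (\<Sum>x\<in>cube n. f x powr r) powr (2 / r)"
  using f
proof (induction n arbitrary: f)
  case 0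
  then show ?case using r by (simp add: noise_def hdist_def powr_powr powr_numeral)
next
  case (Suc n)
  have \<delta>: "0 \<le> \<delta>" "\<delta> \<le> 1"
  proof -
    show "0 \<le> \<delta>" using \<epsilon> by (simp add: \<delta>_def)
    have "1 - \<delta> = (1 - \<epsilon>)\<^sup>2 + \<epsilon>\<^sup>2" by (simp add: \<delta>_def power2_eq_square algebra_simps)
    also have "\<dots> \<ge> 0" by simp
    finally show "\<delta> \<le> 1" by simp
  qed
  define g where "g = (\<lambda>a x. noise n \<epsilon> (\<lambda>y. f (a # y)) x)"
  define N where "N = (\<lambda>a. \<Sum>x\<in>cube n. (g a x)\<^sup>2)"
  define S where "S = (\<lambda>a. \<Sum>x\<in>cube n. f (a # x) powr r)"
  define A where "A = (\<lambda>a. sqrt (c ^ n) * S a powr (1 / r))"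
  have S: "S a \<ge> 0" for a by (auto simp: S_def intro: sum_nonneg)
  have A: "A a \<ge> 0" for a using c by (simp add: A_def)
  have A2: "(A a)\<^sup>2 = c ^ n * S a powr (2 / r)" for a
  proof -
    have "(S a powr (1 / r))\<^sup>2 = S a powr (2 / r)"
      by (simp add: power2_eq_square flip: powr_add)
    then show ?thesis using c by (simp add: A_def power_mult_distrib)
  qed
  have NA: "N a \<le> (A a)\<^sup>2" for a
    unfolding A2 N_def g_def S_def by (rule Suc.IH) (rule Suc.prems)
  have N: "N a \<ge> 0" for a by (auto simp: N_def intro: sum_nonneg)
  have "(\<Sum>x\<in>cube n. g True x * g False x)\<^sup>2 \<le> N True * N False"
    unfolding N_def by (rule Cauchy_Schwarz_ineq_sum)
  also have "\<dots> \<le> (A True)\<^sup>2 * (A False)\<^sup>2" using NA N by (intro mult_mono) auto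
  finally have "(\<Sum>x\<in>cube n. g True x * g False x)\<^sup>2 \<le> (A True * A False)\<^sup>2"
    by (simp add: power_mult_distrib)
  then have CS: "(\<Sum>x\<in>cube n. g True x * g False x) \<le> A True * A False"
    by (rule power2_le_imp_le) (use A in auto)
  have "(\<Sum>x\<in>cube (Suc n). (noise (Suc n) \<epsilon> f x)\<^sup>2)
      = (\<Sum>x\<in>cube n. ((1 - \<epsilon>) * g True x + \<epsilon> * g False x)\<^sup>2 + ((1 - \<epsilon>) * g False x + \<epsilon> * g True x)\<^sup>2)"
    by (simp add: sum_cube_Suc noise_Cons g_def sum.distrib)
  also have "\<dots> = (\<Sum>x\<in>cube n. (1 - \<delta>) * (g True x)\<^sup>2 + (1 - \<delta>) * (g False x)\<^sup>2 + 2 * \<delta> * (g True x * g False x))"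
    by (intro sum.cong refl) (simp add: \<delta>_def power2_eq_square algebra_simps)
  also have "\<dots> = (1 - \<delta>) * N True + (1 - \<delta>) * N False + 2 * \<delta> * (\<Sum>x\<in>cube n. g True x * g False x)"
    by (simp add: N_def sum.distrib sum_distrib_left)
  also have "\<dots> \<le> (1 - \<delta>) * (A True)\<^sup>2 + (1 - \<delta>) * (A False)\<^sup>2 + 2 * \<delta> * (A True * A False)"
    using NA CS \<delta> by (intro add_mono mult_left_mono) auto
  also have "\<dots> \<le> c * (A True powr r + A False powr r) powr (2 / r)"
    using two_point[OF A A, of True False] by (simp add: algebra_simps)
  also have "A True powr r + A False powr r = sqrt (c ^ n) powr r * (S True + S False)"
    using c S r by (simp add: A_def powr_mult powr_powr algebra_simps)
  also have "(sqrt (c ^ n) powr r * (S True + S False)) powr (2 / r) = c ^ n * (S True + S False) powr (2 / r)"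
    using c S r by (simp add: powr_mult powr_powr powr_numeral)
  finally show ?case by (simp add: S_def sum_cube_Suc)
qed

lemma abs_noise_le:
  assumes "0 \<le> \<epsilon>" "\<epsilon> \<le> 1"
  shows "\<bar>noise n \<epsilon> f x\<bar> \<le> noise n \<epsilon> (\<lambda>y. \<bar>f y\<bar>) x"
  unfolding noise_conv_kernel
  by (rule order.trans[OF sum_abs]) (use noise_kernel_nonneg[OF assms] in \<open>simp add: abs_mult\<close>)

section \<open>Counting points of Hamming spheres by sets of flipped coordinates\<close>

definition flip_at :: "bool list \<Rightarrow> nat set \<Rightarrow> bool list" where
  "flip_at y A = map (\<lambda>i. (y ! i) \<noteq> (i \<in> A)) [0..<length y]"

lemma length_flip_at [simp]: "length (flip_at y A) = length y"
  by (simp add: flip_at_def)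

lemma flip_at_nth [simp]: "i < length y \<Longrightarrow> flip_at y A ! i = ((y ! i) \<noteq> (i \<in> A))"
  by (simp add: flip_at_def)

lemma flip_at_in_cube [simp]: "flip_at y A \<in> cube n \<longleftrightarrow> y \<in> cube n"
  by (simp add: cube_def)

lemma inj_on_flip_at: "inj_on (flip_at y) (Pow {..<length y})"
proof (rule inj_onI)
  fix A B assume AB: "A \<in> Pow {..<length y}" "B \<in> Pow {..<length y}" "flip_at y A = flip_at y B"
  have "i \<in> A \<longleftrightarrow> i \<in> B" if "i < length y" for i
    using flip_at_nth[OF that, of A] flip_at_nth[OF that, of B] AB(3) by auto
  then show "A = B" using AB by auto
qed

lemma card_hsphere:
  assumes "z \<in> cube n"
  shows "card (hsphere n z s) = n choose s"
proof -
  have n: "length z = n" using assms by (simp add: cube_def)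
  have "hsphere n z s = flip_at z ` {A. A \<subseteq> {..<n} \<and> card A = s}"
  proof (intro equalityI subsetI)
    fix x assume x: "x \<in> hsphere n z s"
    define A where "A = {i. i < length x \<and> x ! i \<noteq> z ! i}"
    have len: "length x = n" using x by (simp add: hsphere_def cube_def)
    have "x = flip_at z A" using n len by (intro nth_equalityI) (auto simp: A_def)
    moreover have "A \<subseteq> {..<n}" "card A = s" using x len by (auto simp: A_def hsphere_def hdist_def)
    ultimately show "x \<in> flip_at z ` {A. A \<subseteq> {..<n} \<and> card A = s}" by blast
  next
    fix x assume "x \<in> flip_at z ` {A. A \<subseteq> {..<n} \<and> card A = s}"
    then obtain A where A: "x = flip_at z A" "A \<subseteq> {..<n}" "card A = s" by blast
    have "{i. i < n \<and> flip_at z A ! i \<noteq> z ! i} = A" using A n by auto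
    then show "x \<in> hsphere n z s" using A n assms by (simp add: hsphere_def hdist_def)
  qed
  moreover have "inj_on (flip_at z) {A. A \<subseteq> {..<n} \<and> card A = s}"
    by (rule inj_on_subset[OF inj_on_flip_at]) (auto simp: n)
  ultimately have "card (hsphere n z s) = card {A. A \<subseteq> {..<n} \<and> card A = s}"
    by (simp add: card_image)
  then show ?thesis by (simp add: n_subsets)
qed

text \<open>Flipping \<open>k\<close> coordinates where \<open>y\<close> differs from the centre and
  \<open>k\<close> where it agrees leads back to the sphere, at distance \<open>2 * k\<close>;
  distinct choices give distinct points.\<close>

lemma card_hsphere_at_distance_ge:
  assumes z: "z \<in> cube n" and y: "y \<in> hsphere n z s"
  shows "(s choose k) * (n - s choose k) \<le> card {w \<in> hsphere n z s. hdist y w = 2 * k}"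
proof -
  define D where "D = {i. i < length y \<and> y ! i \<noteq> z ! i}"
  have n: "length z = n" "length y = n" using z y by (auto simp: cube_def hsphere_def)
  have D: "D \<subseteq> {..<n}" "card D = s" "finite D" using y n by (auto simp: D_def hsphere_def hdist_def)
  define P where "P = {E. E \<subseteq> D \<and> card E = k} \<times> {F. F \<subseteq> {..<n} - D \<and> card F = k}"
  have inj: "inj_on (\<lambda>(E, F). flip_at y (E \<union> F)) P"
  proof (rule inj_onI, clarify)
    fix E F E' F' assume P: "(E, F) \<in> P" "(E', F') \<in> P" "flip_at y (E \<union> F) = flip_at y (E' \<union> F')"
    have "E \<union> F = E' \<union> F'"
      by (rule inj_onD[OF inj_on_flip_at P(3)]) (use P D n in \<open>auto simp: P_def\<close>)
    then show "E = E' \<and> F = F'" using P by (auto simp: P_def)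
  qed
  have "(\<lambda>(E, F). flip_at y (E \<union> F)) ` P \<subseteq> {w \<in> hsphere n z s. hdist y w = 2 * k}"
  proof clarify
    fix E F assume "(E, F) \<in> P"
    then have EF: "E \<subseteq> D" "card E = k" "F \<subseteq> {..<n} - D" "card F = k" by (auto simp: P_def)
    then have fin: "finite E" "finite F" using D finite_subset[of F "{..<n}"] by (auto intro: finite_subset)
    have "{i. i < n \<and> y ! i \<noteq> flip_at y (E \<union> F) ! i} = E \<union> F" using EF D n by auto
    then have 1: "hdist y (flip_at y (E \<union> F)) = 2 * k"
      using EF fin n by (simp add: hdist_def) (subst card_Un_disjoint, auto)
    have "{i. i < n \<and> flip_at y (E \<union> F) ! i \<noteq> z ! i} = (D - E) \<union> F"
      using EF D n by (auto simp: D_def)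
    then have "hdist (flip_at y (E \<union> F)) z = card ((D - E) \<union> F)" using n by (simp add: hdist_def)
    also have "\<dots> = card (D - E) + card F" using EF fin D by (intro card_Un_disjoint) auto
    also have "card (D - E) = s - k" using EF fin D by (simp add: card_Diff_subset)
    also have "s - k + card F = s" using card_mono[of D E] EF D by simp
    finally show "flip_at y (E \<union> F) \<in> hsphere n z s \<and> hdist y (flip_at y (E \<union> F)) = 2 * k"
      using 1 n by (simp add: hsphere_def cube_def)
  qed
  then have "card P \<le> card {w \<in> hsphere n z s. hdist y w = 2 * k}"
    by (intro card_inj_on_le[OF inj]) (auto simp: hsphere_def)
  moreover have "card P = (s choose k) * (n - s choose k)"
    unfolding P_def using D by (simp add: card_cartesian_product n_subsets card_Diff_subset)
  ultimately show ?thesis by simp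
qed

text \<open>The squared norm is the sum of the \<open>\<delta>\<close>-kernel over ordered pairs of
  points of the sphere. Its terms are nonnegative, so the pairs at one distance \<open>2 * k\<close>
  bound it from below.\<close>

lemma sum_noise_hsphere_ge:
  assumes z: "z \<in> cube n" and \<epsilon>: "0 \<le> \<epsilon>" "\<epsilon> \<le> 1"
  defines "\<delta> \<equiv> 2 * \<epsilon> * (1 - \<epsilon>)"
  shows "real (n choose s) * real (s choose k) * real (n - s choose k) * (\<delta> ^ (2 * k) * (1 - \<delta>) ^ (n - 2 * k))
    \<le> (\<Sum>x\<in>cube n. (noise n \<epsilon> (indicator (hsphere n z s)) x)\<^sup>2)"
proof -
  define S where "S = hsphere n z s"
  have S: "S \<subseteq> cube n" "finite S" by (auto simp: S_def hsphere_def)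
  have \<delta>: "0 \<le> \<delta>" "\<delta> \<le> 1"
  proof -
    show "0 \<le> \<delta>" using \<epsilon> by (simp add: \<delta>_def)
    have "1 - \<delta> = (1 - \<epsilon>)\<^sup>2 + \<epsilon>\<^sup>2" by (simp add: \<delta>_def power2_eq_square algebra_simps)
    also have "\<dots> \<ge> 0" by simp
    finally show "\<delta> \<le> 1" by simp
  qed
  have "(\<Sum>x\<in>cube n. (noise n \<epsilon> (indicator S) x)\<^sup>2) = (\<Sum>y\<in>S. \<Sum>w\<in>S. noise_kernel n \<delta> y w)"
    unfolding sum_noise_squared \<delta>_def[symmetric] using S
    by (simp add: indicator_def if_distrib sum.If_cases Int_absorb1 cong: if_cong)
  also have "\<dots> \<ge> (\<Sum>y\<in>S. real (s choose k) * real (n - s choose k) * (\<delta> ^ (2 * k) * (1 - \<delta>) ^ (n - 2 * k)))"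
  proof (rule sum_mono)
    fix y assume y: "y \<in> S"
    define W where "W = {w \<in> S. hdist y w = 2 * k}"
    have "(s choose k) * (n - s choose k) \<le> card W"
      unfolding W_def S_def using z y by (intro card_hsphere_at_distance_ge) (auto simp: S_def)
    then have "real (s choose k) * real (n - s choose k) \<le> real (card W)"
      by (simp flip: of_nat_mult)
    then have "real (s choose k) * real (n - s choose k) * (\<delta> ^ (2 * k) * (1 - \<delta>) ^ (n - 2 * k))
        \<le> real (card W) * (\<delta> ^ (2 * k) * (1 - \<delta>) ^ (n - 2 * k))"
      using \<delta> by (intro mult_right_mono) auto
    also have "\<dots> = (\<Sum>w\<in>W. noise_kernel n \<delta> y w)"
      by (simp add: W_def noise_kernel_def)
    also have "\<dots> \<le> (\<Sum>w\<in>S. noise_kernel n \<delta> y w)"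
      using S noise_kernel_nonneg[OF \<delta>] by (intro sum_mono2) (auto simp: W_def)
    finally show "real (s choose k) * real (n - s choose k) * (\<delta> ^ (2 * k) * (1 - \<delta>) ^ (n - 2 * k))
      \<le> (\<Sum>w\<in>S. noise_kernel n \<delta> y w)" .
  qed
  finally show ?thesis
    using card_hsphere[OF z, of s] by (simp add: S_def mult_ac)
qed

section \<open>Binomial point probabilities\<close>

text \<open>This is \<open>ln (1 + x) \<ge> 2 * x / (2 + x)\<close> at \<open>x = 1 / k\<close>; the
  difference vanishes at 0 and has derivative \<open>x^2 / ((1 + x) * (2 + x)^2)\<close>.\<close>

lemma half_step_log_ge:
  assumes "k \<ge> (1::real)"
  shows "(k + 1/2) * ln ((k + 1) / k) \<ge> 1"
proof -
  define h where "h = (\<lambda>x::real. ln (1 + x) - 2 * x / (2 + x))"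
  have "h 0 \<le> h (1/k)"
  proof (rule DERIV_nonneg_imp_nondecreasing[of 0 "1/k" h])
    fix x :: real assume x: "0 \<le> x" "x \<le> 1/k"
    have "(h has_real_derivative (1 / (1 + x) - (2 * (2 + x) - 2 * x) / (2 + x)^2)) (at x)"
      unfolding h_def using x by (auto intro!: derivative_eq_intros simp: power2_eq_square)
    moreover have "1 / (1 + x) - (2 * (2 + x) - 2 * x) / (2 + x)^2 = x^2 / ((1 + x) * (2 + x)^2)"
      using x by (simp add: divide_simps) (simp add: algebra_simps power2_eq_square)
    ultimately show "\<exists>y. (h has_real_derivative y) (at x) \<and> 0 \<le> y"
      using x by (intro exI[of _ "x^2 / ((1 + x) * (2 + x)^2)"]) auto
  qed (use assms in auto)
  then have "2 * (1/k) / (2 + 1/k) \<le> ln (1 + 1/k)" by (simp add: h_def)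
  moreover have "2 * (1/k) / (2 + 1/k) = 1 / (k + 1/2)" using assms by (simp add: field_simps)
  moreover have "1 + 1/k = (k + 1) / k" using assms by (simp add: field_simps)
  ultimately have "1 / (k + 1/2) \<le> ln ((k + 1) / k)" by simp
  then show ?thesis using assms by (simp add: field_simps)
qed

text \<open>Equality holds at \<open>k = 1\<close>, and the induction step is
  \<open>(1 + 1 / k) powr (k + 1/2) \<ge> exp 1\<close>.\<close>

lemma fact_le_stirling:
  assumes "k \<ge> 1"
  shows "fact k * exp (real k) \<le> exp 1 * sqrt (real k) * real k ^ k"
  using assms
proof (induction k rule: dec_induct)
  case base
  then show ?case by simp
next
  case (step k)
  have k: "real k \<ge> 1" using step by simp
  have "exp 1 \<le> exp ((real k + 1/2) * ln ((real k + 1) / real k))"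
    using half_step_log_ge[OF k] by simp
  also have "\<dots> = exp (ln ((real k + 1) / real k) * real k) * exp (ln ((real k + 1) / real k) / 2)"
    by (simp add: algebra_simps flip: exp_add)
  also have "exp (ln ((real k + 1) / real k) * real k) = ((real k + 1) / real k) ^ k"
    using k by (simp add: exp_of_nat2_mult)
  also have "exp (ln ((real k + 1) / real k) / 2) = sqrt ((real k + 1) / real k)"
    using k by (subst ln_sqrt[symmetric]) auto
  finally have e: "exp 1 \<le> ((real k + 1) / real k) ^ k * sqrt ((real k + 1) / real k)" .
  have "fact (Suc k) * exp (real (Suc k)) = (real k + 1) * (fact k * exp (real k)) * exp 1"
    by (simp add: algebra_simps exp_add)
  also have "\<dots> \<le> (real k + 1) * (exp 1 * sqrt (real k) * real k ^ k)
      * (((real k + 1) / real k) ^ k * sqrt ((real k + 1) / real k))"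
    by (rule mult_mono[OF mult_left_mono[OF step.IH] e]) auto
  also have "\<dots> = exp 1 * sqrt (real k + 1) * (real k + 1) ^ Suc k"
    using k by (simp add: power_divide real_sqrt_divide field_simps)
  finally show ?case by (simp add: algebra_simps)
qed

text \<open>Estimating \<open>m! / (m - k)!\<close> directly leaves only \<open>fact k\<close> to
  Stirling's bound, so that later losses depend on \<open>k\<close> and not on \<open>m\<close>. The
  induction step is \<open>(1 + 1 / j) ^ j \<le> exp 1\<close> for
  \<open>j = m - k - 1\<close>.\<close>

lemma falling_product_ge:
  assumes "k \<le> m"
  shows "(\<Prod>i<k. real (m - i)) * (1 - real k / real m) ^ (m - k) \<ge> exp (- real k) * real m ^ k"
  using assms
proof (induction k)
  case 0
  then show ?case by simp
next
  case (Suc k)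
  define j where "j = m - Suc k"
  have m: "m = Suc (k + j)" using Suc.prems by (simp add: j_def)
  then have mpos: "real m > 0" by simp
  \<comment> \<open>For \<open>j = 0\<close> this bound and the next rest on
    \<open>1 / 0 = 0\<close> and \<open>0 ^ 0 = 1\<close>.\<close>
  have "(1 + 1 / real j) ^ j \<le> exp 1"
  proof (cases "j = 0")
    case False
    then show ?thesis using exp_ge_one_plus_x_over_n_power_n[of j 1] by simp
  qed simp
  then have e: "(1 + real j) ^ j \<le> exp 1 * real j ^ j"
    by (cases "j = 0") (auto simp: field_simps power_divide add_divide_distrib[symmetric])
  have "exp (- real k) * real m ^ k \<le> (\<Prod>i<k. real (m - i)) * (1 - real k / real m) ^ (m - k)"
    using Suc by simp
  also have "(1 - real k / real m) ^ (m - k) = ((1 + real j) / real m) ^ Suc j"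
    by (simp add: m field_simps)
  also have "\<dots> = (1 + real j) ^ j * (1 + real j) / real m ^ Suc j"
    by (simp add: power_divide)
  also have "(\<Prod>i<k. real (m - i)) * \<dots> \<le> (\<Prod>i<k. real (m - i)) * (exp 1 * real j ^ j * (1 + real j) / real m ^ Suc j)"
    using e by (intro mult_left_mono divide_right_mono mult_right_mono prod_nonneg) auto
  also have "\<dots> = (\<Prod>i<Suc k. real (m - i)) * (real j / real m) ^ j * exp 1 / real m"
    by (simp add: m power_divide field_simps)
  also have "real j / real m = 1 - real (Suc k) / real m" by (simp add: m field_simps)
  finally have "exp (- real k) * real m ^ k * real m / exp 1
       \<le> (\<Prod>i<Suc k. real (m - i)) * (1 - real (Suc k) / real m) ^ j"
    using mpos by (simp add: pos_le_divide_eq pos_divide_le_eq mult_ac del: prod.lessThan_Suc)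
  also have "exp (- real k) * real m ^ k * real m / exp 1 = exp (- real (Suc k)) * real m ^ Suc k"
    by (simp add: exp_diff exp_minus field_simps exp_add)
  finally show ?case by (simp add: j_def)
qed

lemma binomial_at_mean_ge:
  assumes "1 \<le> k" "k \<le> m"
  shows "real (m choose k) * (real k / real m) ^ k * (1 - real k / real m) ^ (m - k)
           \<ge> 1 / (exp 1 * sqrt (real k))"
proof -
  have c: "real (m choose k) = (\<Prod>i<k. real (m - i)) / fact k"
  proof -
    have "real (m choose k) = (\<Prod>i<k. (real m - real i)) / fact k"
      by (simp add: binomial_gbinomial gbinomial_prod_rev atLeast0LessThan)
    also have "(\<Prod>i<k. (real m - real i)) = (\<Prod>i<k. real (m - i))"
      using assms by (intro prod.cong) (auto simp: of_nat_diff)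
    finally show ?thesis .
  qed
  have "1 / (exp 1 * sqrt (real k)) \<le> real k ^ k / (fact k * exp (real k))"
    using fact_le_stirling[OF assms(1)] assms by (simp add: field_simps)
  also have "\<dots> = (exp (- real k) * real m ^ k) * (real k / real m) ^ k / fact k"
    using assms by (simp add: exp_minus power_divide field_simps)
  also have "\<dots> \<le> ((\<Prod>i<k. real (m - i)) * (1 - real k / real m) ^ (m - k)) * (real k / real m) ^ k / fact k"
    using falling_product_ge[OF assms(2)] by (intro divide_right_mono mult_right_mono) auto
  finally show ?thesis by (simp add: c mult_ac)
qed

lemma one_minus_power_ge_half:
  assumes "0 \<le> x" "x \<le> 1/2" "x \<le> real j"
  shows "(1 - x / real j) ^ j \<ge> 1/2"
proof (cases "j = 0")
  case False
  then have "1 + real j * (- x / real j) \<le> (1 + (- x / real j)) ^ j"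
    using assms by (intro Bernoulli_inequality) (auto simp: field_simps)
  then show ?thesis using False assms by simp
qed simp

text \<open>The mean \<open>\<kappa>\<close> need not be an integer. Replacing \<open>k / m\<close>
  by \<open>\<kappa> / m\<close> can lower only one of the two power factors, and by Bernoulli's
  inequality it loses at most a factor 2. A common \<open>M\<close> also covers
  \<open>k = 0\<close>, where the probability at the mean is 1.\<close>

lemma binomial_near_mean_ge:
  assumes "0 \<le> \<kappa>" "\<kappa> \<le> real m" "k \<le> m" "\<bar>\<kappa> - real k\<bar> \<le> 1/2" "1 \<le> M" "k \<le> M"
  shows "real (m choose k) * (\<kappa> / real m) ^ k * (1 - \<kappa> / real m) ^ (m - k)
           \<ge> 1 / (2 * exp 1 * sqrt (real M))"
proof -
  have 1: "real (m choose k) * (real k / real m) ^ k * (1 - real k / real m) ^ (m - k)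
           \<ge> 1 / (exp 1 * sqrt (real M))"
  proof (cases "k = 0")
    case True
    have "1 \<le> exp 1 * sqrt (real M)"
      using mult_mono[of 1 "exp 1" 1 "sqrt (real M)"] assms by simp
    then show ?thesis using True by simp
  next
    case False
    have "1 / (exp 1 * sqrt (real M)) \<le> 1 / (exp 1 * sqrt (real k))"
      using assms False by (intro divide_left_mono) auto
    also have "\<dots> \<le> real (m choose k) * (real k / real m) ^ k * (1 - real k / real m) ^ (m - k)"
      using binomial_at_mean_ge[of k m] False assms by simp
    finally show ?thesis .
  qed
  have 2: "\<kappa> ^ k * (real m - \<kappa>) ^ (m - k) \<ge> 1/2 * (real k ^ k * (real m - real k) ^ (m - k))"
  proof (cases "\<kappa> \<ge> real k")
    case True
    have "(real m - \<kappa>) ^ (m - k) = (real m - real k) ^ (m - k) * (1 - (\<kappa> - real k) / real (m - k)) ^ (m - k)"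
      using assms True by (cases "m = k") (auto simp: of_nat_diff field_simps simp flip: power_mult_distrib)
    also have "\<dots> \<ge> (real m - real k) ^ (m - k) * (1/2)"
      using assms True by (intro mult_left_mono one_minus_power_ge_half) (auto simp: of_nat_diff)
    finally have "(real m - real k) ^ (m - k) * (1/2) \<le> (real m - \<kappa>) ^ (m - k)" .
    moreover have "real k ^ k \<le> \<kappa> ^ k" using True by (intro power_mono) auto
    ultimately have "real k ^ k * ((real m - real k) ^ (m - k) * (1/2)) \<le> \<kappa> ^ k * (real m - \<kappa>) ^ (m - k)"
      using assms by (intro mult_mono) auto
    then show ?thesis by (simp add: mult_ac)
  next
    case False
    have "\<kappa> ^ k = real k ^ k * (1 - (real k - \<kappa>) / real k) ^ k"
      using assms False by (cases "k = 0") (auto simp: field_simps simp flip: power_mult_distrib)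
    also have "\<dots> \<ge> real k ^ k * (1/2)"
      using assms False by (intro mult_left_mono one_minus_power_ge_half) auto
    finally have "real k ^ k * (1/2) \<le> \<kappa> ^ k" .
    moreover have "(real m - real k) ^ (m - k) \<le> (real m - \<kappa>) ^ (m - k)"
      using False assms by (intro power_mono) auto
    ultimately have "(real k ^ k * (1/2)) * (real m - real k) ^ (m - k) \<le> \<kappa> ^ k * (real m - \<kappa>) ^ (m - k)"
      using assms by (intro mult_mono) auto
    then show ?thesis by (simp add: mult_ac)
  qed
  have 3: "(x / real m) ^ k * (1 - x / real m) ^ (m - k) = x ^ k * (real m - x) ^ (m - k) / real m ^ m"
    if "0 \<le> x" "x \<le> real m" for x
  proof (cases "m = 0")
    case True
    then show ?thesis using assms by simp
  next
    case False
    have "(1 - x / real m) = (real m - x) / real m" using False by (simp add: field_simps)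
    moreover have "real m ^ m = real m ^ k * real m ^ (m - k)"
      using assms by (simp flip: power_add)
    ultimately show ?thesis by (simp add: power_divide)
  qed
  have "1/2 * (1 / (exp 1 * sqrt (real M))) \<le> 1/2 * (real (m choose k) * ((real k / real m) ^ k * (1 - real k / real m) ^ (m - k)))"
    using 1 by (simp add: mult_ac)
  also have "\<dots> = real (m choose k) * ((1/2 * (real k ^ k * (real m - real k) ^ (m - k))) / real m ^ m)"
    using assms by (subst 3) auto
  also have "\<dots> \<le> real (m choose k) * ((\<kappa> ^ k * (real m - \<kappa>) ^ (m - k)) / real m ^ m)"
    using 2 by (intro mult_left_mono divide_right_mono) auto
  also have "\<dots> = real (m choose k) * ((\<kappa> / real m) ^ k * (1 - \<kappa> / real m) ^ (m - k))"
    using assms by (subst 3) auto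
  finally show ?thesis by (simp add: mult_ac)
qed

section \<open>The norm inequality and its tightness on spheres\<close>

lemma log_cnorm:
  assumes "0 < q" "(\<Sum>x\<in>cube n. \<bar>f x\<bar> powr q) > 0"
  shows "log 2 (cnorm n q f) = (log 2 (\<Sum>x\<in>cube n. \<bar>f x\<bar> powr q) - real n) / q" "cnorm n q f > 0"
  using assms by (simp_all add: cnorm_def log_powr log_divide log_nat_power)

text \<open>All comparisons are made between base-2 logarithms, in which the norms and the
  interpolated bound are linear in \<open>log 2 S1\<close> and \<open>log 2 Sp\<close>.\<close>

lemma cnorm_noise_le:
  fixes f :: "bool list \<Rightarrow> real"
  assumes n: "1 \<le> n" and nz: "\<exists>x\<in>cube n. f x \<noteq> 0" and \<epsilon>: "0 \<le> \<epsilon>" "\<epsilon> < 1/2"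
    and p: "p = 1 + (1 - 2 * \<epsilon>)\<^sup>2"
  shows "cnorm n 2 (noise n \<epsilon> f) \<le> 2 powr (eta (rnorm n f p) \<epsilon> * real n) * cnorm n p f"
proof -
  define \<delta> where "\<delta> = 2 * \<epsilon> * (1 - \<epsilon>)"
  have p\<delta>: "p = 2 * (1 - \<delta>)" by (simp add: p \<delta>_def power2_eq_square algebra_simps)
  have p1: "p > 1" using \<epsilon> by (simp add: p)
  have \<delta>: "0 \<le> \<delta>" "\<delta> < 1/2" using \<epsilon> p1 p\<delta> by (auto simp: \<delta>_def)
  define S1 where "S1 = (\<Sum>x\<in>cube n. \<bar>f x\<bar>)"
  define Sp where "Sp = (\<Sum>x\<in>cube n. \<bar>f x\<bar> powr p)"
  obtain x0 where x0: "x0 \<in> cube n" "f x0 \<noteq> 0" using nz by blast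
  have S1: "S1 > 0" unfolding S1_def using x0 by (intro sum_pos2[of _ x0]) auto
  have Sp: "Sp > 0" unfolding Sp_def using x0 by (intro sum_pos2[of _ x0]) auto
  define s1 where "s1 = log 2 S1"
  define sp where "sp = log 2 Sp"
  have l1: "log 2 (cnorm n 1 f) = s1 - real n" "cnorm n 1 f > 0"
    using log_cnorm[where q = 1 and n = n and f = f] S1 by (auto simp: s1_def S1_def)
  have lp: "log 2 (cnorm n p f) = (sp - real n) / p" "cnorm n p f > 0"
    using log_cnorm[where q = p and n = n and f = f] Sp p1 by (auto simp: sp_def Sp_def)
  \<comment> \<open>\<open>L\<close> is \<open>n * r(p)\<close>; the terms \<open>real n\<close>
    come from the uniform measure.\<close>
  define L where "L = (sp - real n) / p - s1 + real n"
  have rn: "rnorm n f p = L / real n"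
    using l1 lp by (simp add: rnorm_def log_divide L_def)
  have "S1 \<le> Sp powr (1 / p) * (2 ^ n) powr (1 - 1 / p)"
    using sum_le_powr_mean[of "cube n" p "\<lambda>x. \<bar>f x\<bar>"] nz p1 by (simp add: S1_def Sp_def card_cube)
  then have "s1 \<le> log 2 (Sp powr (1 / p) * (2 ^ n) powr (1 - 1 / p))"
    unfolding s1_def using S1 by (intro log_mono) auto
  also have "\<dots> = sp / p + (1 - 1 / p) * real n"
    using Sp by (simp add: log_mult log_powr sp_def log_nat_power)
  finally have L0: "L \<ge> 0" by (simp add: L_def diff_divide_distrib algebra_simps)
  have "Sp \<le> S1 powr p"
    using sum_powr_le_powr_sum[of "cube n" p "\<lambda>x. \<bar>f x\<bar>"] p1 by (simp add: S1_def Sp_def)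
  then have "sp \<le> log 2 (S1 powr p)"
    unfolding sp_def using Sp by (intro log_mono) auto
  then have "sp \<le> p * s1" using S1 by (simp add: log_powr s1_def)
  then have "sp / p \<le> s1" using p1 by (simp add: field_simps)
  then have "L \<le> real n - real n / p" by (simp add: L_def diff_divide_distrib)
  also have "\<dots> = (p - 1) / p * real n" using p1 by (simp add: field_simps)
  finally have L1: "L \<le> (p - 1) / p * real n" .
  \<comment> \<open>The argument of \<open>bin_entropy_inv\<close> in \<open>eta\<close>; the two
    bounds on \<open>L\<close> place it in \<open>[0, 1]\<close>.\<close>
  define y where "y = 1 - p / (p - 1) * (L / real n)"
  have y: "0 \<le> y" "y \<le> 1"
    using L0 L1 p1 n by (auto simp: y_def field_simps)
  define \<sigma> where "\<sigma> = bin_entropy_inv y"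
  have \<sigma>: "0 \<le> \<sigma>" "\<sigma> \<le> 1/2" "bin_entropy \<sigma> = y"
    unfolding \<sigma>_def using bin_entropy_inv[OF y] by auto
  obtain r c where r: "1 \<le> r" "r \<le> 2 * (1 - \<delta>)" and c: "0 < c"
    and two: "\<And>a b. 0 \<le> a \<Longrightarrow> 0 \<le> b \<Longrightarrow>
       (1 - \<delta>) * (a\<^sup>2 + b\<^sup>2) + 2 * \<delta> * a * b \<le> c * (a powr r + b powr r) powr (2 / r)"
    and ph: "log 2 c - 1 + 2 / r * bin_entropy \<sigma> \<le> phi \<sigma> \<delta>"
    using two_point_bound_phi[OF \<sigma>(1,2) \<delta>] by metis
  define Q where "Q = (\<Sum>x\<in>cube n. (noise n \<epsilon> f x)\<^sup>2)"
  define \<alpha> where "\<alpha> = (p - r) / (p - 1)"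
  define \<beta> where "\<beta> = (r - 1) / (p - 1)"
  define R where "R = c ^ n * (S1 powr \<alpha> * Sp powr \<beta>) powr (2 / r)"
  have "Q \<le> (\<Sum>x\<in>cube n. (noise n \<epsilon> (\<lambda>y. \<bar>f y\<bar>) x)\<^sup>2)"
    unfolding Q_def
  proof (rule sum_mono)
    show "(noise n \<epsilon> f x)\<^sup>2 \<le> (noise n \<epsilon> (\<lambda>y. \<bar>f y\<bar>) x)\<^sup>2" for x
      using abs_noise_le[of \<epsilon> n f x] \<epsilon> by (simp add: abs_le_square_iff[symmetric])
  qed
  also have "\<dots> \<le> c ^ n * (\<Sum>x\<in>cube n. \<bar>f x\<bar> powr r) powr (2 / r)"
    by (rule noise_tensorization) (use r c \<epsilon> two in \<open>auto simp: \<delta>_def\<close>)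
  also have "\<dots> \<le> R"
    unfolding R_def S1_def Sp_def \<alpha>_def \<beta>_def using c r p1 p\<delta>
    by (intro mult_left_mono powr_mono2 sum_powr_interpolation) (auto intro: sum_nonneg)
  finally have QR: "Q \<le> R" .
  have R: "R > 0" using c S1 Sp by (simp add: R_def)
  have lR: "log 2 R = real n * log 2 c + 2 / r * (\<alpha> * s1 + \<beta> * sp)"
    using c S1 Sp by (simp add: R_def log_mult log_powr log_nat_power s1_def sp_def)
  have "cnorm n 2 (noise n \<epsilon> f) = (Q / 2 ^ n) powr (1 / 2)"
    by (simp add: cnorm_def Q_def)
  also have "\<dots> \<le> (R / 2 ^ n) powr (1 / 2)"
    using QR by (intro powr_mono2 divide_right_mono divide_nonneg_nonneg) (auto simp: Q_def intro!: sum_nonneg)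
  also have "\<dots> \<le> 2 powr (eta (rnorm n f p) \<epsilon> * real n) * cnorm n p f"
  proof -
    have n0: "real n > 0" using n by simp
    have "eta (rnorm n f p) \<epsilon> = 1/2 * phi \<sigma> \<delta> + (L / real n) / (p - 1)"
      by (simp add: eta_def eta_q_def phi_tilde_def p[symmetric] \<delta>_def \<sigma>_def y_def rn)
    then have f1: "eta (rnorm n f p) \<epsilon> * real n = 1/2 * (phi \<sigma> \<delta> * real n) + L / (p - 1)"
      using n0 by (simp add: distrib_right)
    have f2: "(log 2 c - 1 + 2 / r * y) * real n \<le> phi \<sigma> \<delta> * real n"
      using ph \<sigma>(3) by (intro mult_right_mono) auto
    have f3: "(log 2 c - 1 + 2 / r * y) * real n
       = real n * log 2 c - real n + 2 / r * (real n - p / (p - 1) * L)"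
    proof -
      have "y * real n = real n - p / (p - 1) * (L / real n * real n)"
        by (simp only: y_def left_diff_distrib mult.assoc mult_1)
      then have "y * real n = real n - p / (p - 1) * L" using n0 by simp
      moreover have "(log 2 c - 1 + 2 / r * y) * real n = real n * log 2 c - real n + 2 / r * (y * real n)"
        by (simp add: algebra_simps)
      ultimately show ?thesis by simp
    qed
    \<comment> \<open>The interpolated bound separates into the entropy term of the dual form of
      \<open>phi\<close>, the summand \<open>x / (p - 1)\<close> of \<open>eta\<close> scaled by
      \<open>n\<close>, and the logarithm of the \<open>p\<close>-norm.\<close>
    have f4: "1 / r * (\<alpha> * s1 + \<beta> * sp) = 1 / r * (real n - p / (p - 1) * L) + L / (p - 1) + (sp - real n) / p"
    proof -
      define d where "d = p - 1"
      have pd: "p = d + 1" "d > 0" using p1 by (auto simp: d_def)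
      have e: "(\<alpha> * s1 + \<beta> * sp) * d = (p - r) * s1 + (r - 1) * sp"
        using pd by (simp add: \<alpha>_def \<beta>_def add_divide_distrib[symmetric])
      have lhs: "1 / r * (\<alpha> * s1 + \<beta> * sp) = ((p - r) * s1 + (r - 1) * sp) / (r * d)"
        unfolding e[symmetric] using pd r by simp
      have pL: "p * L = sp - real n - p * s1 + p * real n" using p1 by (simp add: L_def field_simps)
      have Lp: "(sp - real n) / p = L + s1 - real n" by (simp add: L_def)
      have "1 / r * (real n - p / (p - 1) * L) + L / (p - 1) + (sp - real n) / p
        = (d * real n - p * L + r * L + r * d * (L + s1 - real n)) / (r * d)"
        unfolding Lp d_def[symmetric] using pd r by (simp add: field_simps)
      also have "d * real n - p * L + r * L + r * d * (L + s1 - real n)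
          = (p - r) * s1 + (r - 1) * sp"
      proof -
        have "d * real n - p * L + r * L + r * d * (L + s1 - real n)
            = (p - 1) * real n - p * L + r * (p * L) + r * (p - 1) * (s1 - real n)"
          by (simp add: d_def algebra_simps)
        then show ?thesis unfolding pL by (simp add: algebra_simps)
      qed
      finally show ?thesis using lhs by simp
    qed
    have "log 2 R = real n * log 2 c + 2 * (1 / r * (\<alpha> * s1 + \<beta> * sp))"
      using lR by simp
    moreover have "(log 2 c - 1 + 2 / r * y) * real n
       = real n * log 2 c - real n + 2 * (1 / r * (real n - p / (p - 1) * L))"
      using f3 by simp
    \<comment> \<open>With the products named, the claim is linear:
      \<open>(A - n) / 2 = K / 2 + F + D\<close>, and \<open>K \<le> P\<close>.\<close>
    moreover have "(A - real n) / 2 \<le> E + D"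
      if "A = N + 2 * (B + F + D)" "K = N - real n + 2 * B" "E = 1/2 * P + F" "K \<le> P" for A B D E F K N P
      using that by argo
    ultimately have "(log 2 R - real n) / 2 \<le> eta (rnorm n f p) \<epsilon> * real n + (sp - real n) / p"
      unfolding f4 using f1 f2 by blast
    moreover have "log 2 ((R / 2 ^ n) powr (1 / 2)) = (log 2 R - real n) / 2"
      using R by (simp add: log_powr log_divide log_nat_power)
    moreover have "log 2 (2 powr (eta (rnorm n f p) \<epsilon> * real n) * cnorm n p f)
        = eta (rnorm n f p) \<epsilon> * real n + (sp - real n) / p"
      using lp by (simp add: log_mult log_powr)
    ultimately have "log 2 ((R / 2 ^ n) powr (1 / 2)) \<le> log 2 (2 powr (eta (rnorm n f p) \<epsilon> * real n) * cnorm n p f)"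
      by (simp only:)
    then show ?thesis using R lp by (subst (asm) log_le_cancel_iff) auto
  qed
  finally show ?thesis .
qed

section \<open>Tightness on Hamming spheres\<close>

text \<open>The product of the three binomial probabilities is the product of the three coefficients
  times \<open>\<delta> ^ (2 * k) * (1 - \<delta>) ^ (n - 2 * k) * t ^ (2 * (n - s)) / Z ^
  n\<close>, up to rounding the mean to \<open>k\<close>. Bounding each probability below and
  solving for \<open>Z ^ n / t ^ (2 * (n - s))\<close> gives the claim.\<close>

lemma sphere_overlap_ge:
  fixes n s :: nat and \<delta> t :: real
  assumes s: "1 \<le> s" "2 * s \<le> n" and \<delta>: "0 \<le> \<delta>" "\<delta> \<le> 1/2" and t: "t \<ge> 1"
  defines "Z \<equiv> (1 - \<delta>) * (t\<^sup>2 + 1) + 2 * \<delta> * t"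
  assumes st: "real s / real n * Z = \<delta> * t + (1 - \<delta>)"
  obtains k where "Z ^ n / t ^ (2 * (n - s)) \<le> 4 * exp 1 ^ 3 * (real s * sqrt (real s))
    * (real (n choose s) * real (s choose k) * real (n - s choose k) * (\<delta> ^ (2 * k) * (1 - \<delta>) ^ (n - 2 * k)))"
proof -
  have Z: "Z > 0" using \<delta> t unfolding Z_def by (intro add_pos_nonneg mult_pos_pos add_nonneg_pos) auto
  have n0: "real n > 0" "real s > 0" "real (n - s) > 0" using s by auto
  \<comment> \<open>The expected size of each off-diagonal cell among \<open>n\<close> independent
    pairs of bits with the tilted law; the diagonal cells then have expected sizes
    \<open>s - \<kappa>\<close> and \<open>n - s - \<kappa>\<close>.\<close>
  define \<kappa> where "\<kappa> = real n * (\<delta> * t / Z)"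
  have \<kappa>0: "\<kappa> \<ge> 0" using \<delta> t Z by (simp add: \<kappa>_def)
  have e01: "\<kappa> / real n = \<delta> * t / Z" using n0 by (simp add: \<kappa>_def)
  have e11: "(real s - \<kappa>) / real n = (1 - \<delta>) / Z"
  proof -
    have "(real s - \<kappa>) / real n = real s / real n - \<delta> * t / Z"
      using e01 by (simp add: diff_divide_distrib)
    also have "real s / real n = (\<delta> * t + (1 - \<delta>)) / Z" using st Z by (simp add: eq_divide_eq)
    finally show ?thesis by (simp add: add_divide_distrib diff_divide_distrib)
  qed
  have "(real n - real s - \<kappa>) / real n = 1 - (real s - \<kappa>) / real n - 2 * (\<kappa> / real n)"
    using n0 by (simp add: field_simps)
  also have "\<dots> = (Z - (1 - \<delta>) - 2 * \<delta> * t) / Z"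
    unfolding e11 e01 using Z by (simp add: field_simps)
  also have "Z - (1 - \<delta>) - 2 * \<delta> * t = (1 - \<delta>) * t\<^sup>2" by (simp add: Z_def algebra_simps)
  finally have e00: "(real n - real s - \<kappa>) / real n = (1 - \<delta>) * t\<^sup>2 / Z" .
  have "(real s - \<kappa>) / real n \<ge> 0" unfolding e11 using \<delta> Z by simp
  then have \<kappa>s: "\<kappa> \<le> real s" using n0 by (simp add: zero_le_divide_iff)
  define k where "k = nat (round \<kappa>)"
  have "round \<kappa> \<ge> 0" using round_mono[OF \<kappa>0] by simp
  then have rk: "real k = of_int (round \<kappa>)" by (simp add: k_def)
  have k\<kappa>: "\<bar>\<kappa> - real k\<bar> \<le> 1/2"
    unfolding rk using of_int_round_abs_le[of \<kappa>] by (simp add: abs_minus_commute)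
  have ks: "k \<le> s" using round_mono[OF \<kappa>s] by (simp add: k_def nat_le_iff)
  define a where "a = s - k"
  define b where "b = n - s - k"
  have ab: "s = k + a" "n - s = k + b" "n = s + (k + b)" "n - 2 * k = a + b" "s - k = a" "n - s - k = b"
    using ks s by (auto simp: a_def b_def)
  have B1: "1 / (exp 1 * sqrt (real s)) \<le> real (n choose s) * (real s / real n) ^ s * (1 - real s / real n) ^ (n - s)"
    using s by (intro binomial_at_mean_ge) auto
  have B2: "1 / (2 * exp 1 * sqrt (real s)) \<le> real (s choose k) * (\<kappa> / real s) ^ k * (1 - \<kappa> / real s) ^ (s - k)"
    using \<kappa>0 \<kappa>s ks k\<kappa> s by (intro binomial_near_mean_ge) auto
  \<comment> \<open>Although there are \<open>n - s\<close> trials, \<open>k \<le> s\<close> keeps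
    the loss at order \<open>sqrt s\<close>.\<close>
  have B3: "1 / (2 * exp 1 * sqrt (real s)) \<le> real (n - s choose k) * (\<kappa> / real (n - s)) ^ k * (1 - \<kappa> / real (n - s)) ^ (n - s - k)"
    using \<kappa>0 \<kappa>s ks k\<kappa> s by (intro binomial_near_mean_ge) auto
  have "1 / (exp 1 * sqrt (real s)) * (1 / (2 * exp 1 * sqrt (real s))) * (1 / (2 * exp 1 * sqrt (real s)))
    \<le> (real (n choose s) * (real s / real n) ^ s * (1 - real s / real n) ^ (n - s))
      * (real (s choose k) * (\<kappa> / real s) ^ k * (1 - \<kappa> / real s) ^ (s - k))
      * (real (n - s choose k) * (\<kappa> / real (n - s)) ^ k * (1 - \<kappa> / real (n - s)) ^ (n - s - k))"
  proof (intro mult_mono B1 B2 B3)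
    have "0 \<le> 1 / (exp 1 * sqrt (real s))" by simp
    then show "0 \<le> real (n choose s) * (real s / real n) ^ s * (1 - real s / real n) ^ (n - s)"
      using B1 by linarith
    moreover have "0 \<le> 1 / (2 * exp 1 * sqrt (real s))" by simp
    then have "0 \<le> real (s choose k) * (\<kappa> / real s) ^ k * (1 - \<kappa> / real s) ^ (s - k)"
      using B2 by linarith
    ultimately show "0 \<le> real (n choose s) * (real s / real n) ^ s * (1 - real s / real n) ^ (n - s)
        * (real (s choose k) * (\<kappa> / real s) ^ k * (1 - \<kappa> / real s) ^ (s - k))"
      by (rule mult_nonneg_nonneg)
  qed simp_all
  \<comment> \<open>Marginal times conditional probability: grouped by cell, the powers have the
    tilted joint law as bases.\<close>
  also have "\<dots> = real (n choose s) * real (s choose k) * real (n - s choose k)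
      * (((real s / real n) * (\<kappa> / real s)) ^ k * ((real s / real n) * (1 - \<kappa> / real s)) ^ a
      * ((1 - real s / real n) * (\<kappa> / real (n - s))) ^ k * ((1 - real s / real n) * (1 - \<kappa> / real (n - s))) ^ b)"
  proof -
    have 1: "(real s / real n) ^ s = (real s / real n) ^ k * (real s / real n) ^ a"
      unfolding power_add[symmetric] ab(1)[symmetric] ..
    have 2: "(1 - real s / real n) ^ (n - s) = (1 - real s / real n) ^ k * (1 - real s / real n) ^ b"
      unfolding power_add[symmetric] ab(2)[symmetric] ..
    show ?thesis unfolding 1 2 ab(5,6) power_mult_distrib by (simp only: mult_ac)
  qed
  also have "(real s / real n) * (\<kappa> / real s) = \<delta> * t / Z"
    using n0 unfolding e01[symmetric] by simp
  also have "(real s / real n) * (1 - \<kappa> / real s) = (1 - \<delta>) / Z"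
    using n0 unfolding e11[symmetric] by (simp add: field_simps)
  also have ns: "1 - real s / real n = real (n - s) / real n"
    using n0 s by (simp add: field_simps of_nat_diff)
  also have "real (n - s) / real n * (\<kappa> / real (n - s)) = \<delta> * t / Z"
    using n0 unfolding e01[symmetric] by simp
  also have "real (n - s) / real n * (1 - \<kappa> / real (n - s)) = (1 - \<delta>) * t\<^sup>2 / Z"
  proof -
    have "real (n - s) / real n * (1 - \<kappa> / real (n - s)) = (real (n - s) - \<kappa>) / real n"
      using n0 by (simp add: field_simps)
    also have "\<dots> = (1 - \<delta>) * t\<^sup>2 / Z"
      unfolding e00[symmetric] using s by (simp add: of_nat_diff)
    finally show ?thesis .
  qed
  also have "(\<delta> * t / Z) ^ k * ((1 - \<delta>) / Z) ^ a * (\<delta> * t / Z) ^ k * ((1 - \<delta>) * t\<^sup>2 / Z) ^ b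
      = \<delta> ^ (2 * k) * (1 - \<delta>) ^ (n - 2 * k) * (t ^ (2 * (n - s)) / Z ^ n)"
  proof -
    have 1: "t ^ (2 * (n - s)) = t ^ k * t ^ k * (t\<^sup>2) ^ b"
    proof -
      have "2 * (n - s) = k + k + 2 * b" using ab(2) by simp
      then show ?thesis by (simp only: power_add power_mult)
    qed
    have "n = k + a + (k + b)" using ab by simp
    then have 2: "Z ^ n = Z ^ k * Z ^ a * (Z ^ k * Z ^ b)" by (simp only: power_add)
    have 3: "\<delta> ^ (2 * k) = \<delta> ^ k * \<delta> ^ k" by (simp only: mult_2 power_add)
    show ?thesis unfolding 1 2 3 ab(4) power_add by (simp add: power_mult_distrib power_divide mult_ac)
  qed
  finally have main: "1 / (exp 1 * sqrt (real s)) * (1 / (2 * exp 1 * sqrt (real s))) * (1 / (2 * exp 1 * sqrt (real s)))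
    \<le> real (n choose s) * real (s choose k) * real (n - s choose k)
      * (\<delta> ^ (2 * k) * (1 - \<delta>) ^ (n - 2 * k) * (t ^ (2 * (n - s)) / Z ^ n))" .
  have "1 / (exp 1 * sqrt (real s)) * (1 / (2 * exp 1 * sqrt (real s))) * (1 / (2 * exp 1 * sqrt (real s)))
      = 1 / (4 * exp 1 ^ 3 * (real s * sqrt (real s)))"
    using n0 by (simp add: power3_eq_cube)
  with main have "1 / (4 * exp 1 ^ 3 * (real s * sqrt (real s)))
     \<le> (real (n choose s) * real (s choose k) * real (n - s choose k) * (\<delta> ^ (2 * k) * (1 - \<delta>) ^ (n - 2 * k)))
       * (t ^ (2 * (n - s)) / Z ^ n)" by (simp only: mult_ac)
  moreover define X where "X = real (n choose s) * real (s choose k) * real (n - s choose k) * (\<delta> ^ (2 * k) * (1 - \<delta>) ^ (n - 2 * k))"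
  moreover define Y where "Y = 4 * exp 1 ^ 3 * (real s * sqrt (real s))"
  ultimately have "1 / Y \<le> X * (t ^ (2 * (n - s)) / Z ^ n)" by simp
  moreover have "Y > 0" using n0 by (simp add: Y_def)
  ultimately have "Z ^ n / t ^ (2 * (n - s)) \<le> Y * X"
    using t Z by (simp add: field_simps)
  then show ?thesis using that[of k] by (simp add: X_def Y_def)
qed

text \<open>The probability of \<open>s\<close> successes in \<open>n\<close> trials of rate
  \<open>s / n\<close> is at most 1.\<close>

lemma log_binomial_le:
  assumes "1 \<le> s" "s < n"
  shows "log 2 (real (n choose s)) \<le> real n * bin_entropy (real s / real n)"
proof -
  define x where "x = real s / real n"
  have x: "0 < x" "x < 1" using assms by (auto simp: x_def)
  have "real (n choose s) * x ^ s * (1 - x) ^ (n - s)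
      \<le> (\<Sum>i\<le>n. real (n choose i) * x ^ i * (1 - x) ^ (n - i))"
    using x assms by (intro member_le_sum[of s]) auto
  also have "\<dots> = 1" using binomial_ring[of x "1 - x" n] by simp
  finally have "log 2 (real (n choose s) * x ^ s * (1 - x) ^ (n - s)) \<le> log 2 1"
    using x assms by (intro log_mono) (auto simp: zero_less_binomial)
  then have "log 2 (real (n choose s)) + real s * log 2 x + real (n - s) * log 2 (1 - x) \<le> 0"
    using x assms by (simp add: log_mult log_nat_power zero_less_binomial)
  moreover have "real s = real n * x" "real (n - s) = real n * (1 - x)"
    using assms by (auto simp: x_def field_simps of_nat_diff)
  ultimately show ?thesis
    using assms by (simp add: x_def[symmetric] bin_entropy_def algebra_simps)
qed

text \<open>Here \<open>\<sigma>\<close> is determined by the size of the sphere and is only known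
  to be at most \<open>s / n\<close>. Since \<open>phi_le\<close> holds for every
  \<open>t > 0\<close>, the tilt for \<open>s / n\<close> may be used in it, which matches the bound
  on the overlap.\<close>

lemma cnorm_noise_hsphere_ge:
  fixes f :: "bool list \<Rightarrow> real"
  assumes s: "1 \<le> s" "real s \<le> real n / 2" and z: "z \<in> cube n" and c: "c \<noteq> 0"
    and f: "\<forall>x\<in>cube n. f x = c * indicator (hsphere n z s) x"
    and \<epsilon>: "0 \<le> \<epsilon>" "\<epsilon> < 1/2" and p: "p = 1 + (1 - 2 * \<epsilon>)\<^sup>2"
  shows "2 powr (eta (rnorm n f p) \<epsilon> * real n) * cnorm n p f
           \<le> sqrt (4 * exp 1 ^ 3) * real s powr (3/4) * cnorm n 2 (noise n \<epsilon> f)"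
proof -
  define \<delta> where "\<delta> = 2 * \<epsilon> * (1 - \<epsilon>)"
  have p\<delta>: "p = 2 * (1 - \<delta>)" by (simp add: p \<delta>_def power2_eq_square algebra_simps)
  have p1: "p > 1" using \<epsilon> by (simp add: p)
  have \<delta>: "0 \<le> \<delta>" "\<delta> < 1/2" using \<epsilon> p1 p\<delta> by (auto simp: \<delta>_def)
  have sn: "2 * s \<le> n" "s < n" "s \<le> n" using s by auto
  have n0: "real n > 0" using sn s by simp
  define S where "S = hsphere n z s"
  have S: "S \<subseteq> cube n" "finite S" "card S = n choose s"
    using card_hsphere[OF z] by (auto simp: S_def hsphere_def)
  define M where "M = real (n choose s)"
  have M: "M > 0" using sn by (simp add: M_def zero_less_binomial)
  have sumq: "(\<Sum>x\<in>cube n. \<bar>f x\<bar> powr q) = \<bar>c\<bar> powr q * M" if "q > 0" for q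
  proof -
    have "(\<Sum>x\<in>cube n. \<bar>f x\<bar> powr q) = (\<Sum>x\<in>cube n. if x \<in> S then \<bar>c\<bar> powr q else 0)"
      using f by (intro sum.cong) (auto simp: S_def[symmetric] indicator_def)
    also have "\<dots> = \<bar>c\<bar> powr q * M" using S by (simp add: sum.If_cases Int_absorb1 M_def)
    finally show ?thesis .
  qed
  define m where "m = log 2 M"
  have ln: "log 2 (cnorm n q f) = log 2 \<bar>c\<bar> + (m - real n) / q" "cnorm n q f > 0" if "q > 0" for q
    using log_cnorm[where q = q and n = n and f = f] that c M
    by (auto simp: sumq log_mult log_powr m_def field_simps)
  have rn: "rnorm n f p = ((m - real n) / p - (m - real n)) / real n"
    using ln[of 1] ln[of p] p1 by (simp add: rnorm_def log_divide)
  \<comment> \<open>For a multiple of an indicator,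
    \<open>rnorm n f p = (1 - 1 / p) * (n - m) / n\<close>, so the factor \<open>p / (p - 1)\<close>
    cancels.\<close>
  have y: "1 - p / (p - 1) * rnorm n f p = m / real n"
  proof -
    have "p / (p - 1) * rnorm n f p = p / (p - 1) * (1 / p - 1) * ((m - real n) / real n)"
      by (simp add: rn field_simps)
    also have "p / (p - 1) * (1 / p - 1) = - 1" using p1 by (simp add: field_simps)
    finally show ?thesis using n0 by (simp add: field_simps)
  qed
  have x1: "rnorm n f p / (p - 1) * real n = (real n - m) / p"
  proof -
    have "rnorm n f p * real n = (m - real n) / p - (m - real n)" using n0 by (simp add: rn)
    also have "\<dots> = (real n - m) * (1 - 1 / p)" by (simp add: algebra_simps diff_divide_distrib)
    also have "1 - 1 / p = (p - 1) / p" using p1 by (simp add: field_simps)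
    finally show ?thesis using p1 by (simp add: field_simps)
  qed
  define \<sigma> where "\<sigma> = bin_entropy_inv (m / real n)"
  have "M \<ge> 1" using zero_less_binomial[OF sn(3)] by (simp add: M_def Suc_le_eq)
  moreover have "M \<le> 2 ^ n"
    unfolding M_def using binomial_le_pow2[of n s] by (simp flip: of_nat_le_iff)
  ultimately have m: "0 \<le> m" "m \<le> real n"
    using M by (auto simp: m_def log_le_iff powr_realpow)
  have \<sigma>: "0 \<le> \<sigma>" "\<sigma> \<le> 1/2" "bin_entropy \<sigma> = m / real n"
    unfolding \<sigma>_def using bin_entropy_inv[of "m / real n"] m n0 by auto
  have "m \<le> real n * bin_entropy (real s / real n)"
    unfolding m_def M_def using s sn by (intro log_binomial_le) auto
  then have "bin_entropy \<sigma> \<le> bin_entropy (real s / real n)"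
    unfolding \<sigma>(3) using n0 by (simp add: pos_divide_le_eq mult.commute)
  then have \<sigma>s: "\<sigma> \<le> real s / real n"
    using bin_entropy_strict_mono[of "real s / real n" \<sigma>] \<sigma>(2) by fastforce
  have sn2: "0 < real s / real n" "real s / real n \<le> 1/2" using s n0 by (auto simp: field_simps)
  obtain t where t: "t \<ge> 1"
    and st: "real s / real n * ((1 - \<delta>) * (t\<^sup>2 + 1) + 2 * \<delta> * t) = \<delta> * t + (1 - \<delta>)"
    using tilting_exists[OF sn2, of \<delta>] \<delta> by auto
  define Z where "Z = (1 - \<delta>) * (t\<^sup>2 + 1) + 2 * \<delta> * t"
  have Z: "Z > 0" using \<delta> t unfolding Z_def by (intro add_pos_nonneg mult_pos_pos add_nonneg_pos) auto
  have "phi \<sigma> \<delta> \<le> log 2 Z - 2 * (1 - \<sigma>) * log 2 t - 1"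
    unfolding Z_def using \<sigma> \<delta> t by (intro phi_le) auto
  \<comment> \<open>The direction is right because \<open>t \<ge> 1\<close> makes
    \<open>log 2 t\<close> nonnegative.\<close>
  also have "\<dots> \<le> log 2 Z - 2 * (1 - real s / real n) * log 2 t - 1"
    using \<sigma>s t by (intro diff_right_mono diff_left_mono mult_right_mono) auto
  finally have "real n * phi \<sigma> \<delta> \<le> real n * (log 2 Z - 2 * (1 - real s / real n) * log 2 t - 1)"
    using n0 by (intro mult_left_mono) auto
  also have "\<dots> = log 2 (Z ^ n / t ^ (2 * (n - s)) / 2 ^ n)"
  proof -
    have "log 2 (Z ^ n / t ^ (2 * (n - s)) / 2 ^ n) = real n * log 2 Z - real (2 * (n - s)) * log 2 t - real n"
      using Z t by (simp add: log_divide_pos log_mult log_nat_power)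
    also have "real (2 * (n - s)) = real n * (2 * (1 - real s / real n))"
      using sn n0 by (simp add: of_nat_diff right_diff_distrib)
    finally show ?thesis by (simp add: algebra_simps)
  qed
  finally have "2 powr (real n * phi \<sigma> \<delta>) \<le> 2 powr log 2 (Z ^ n / t ^ (2 * (n - s)) / 2 ^ n)"
    by simp
  also have "\<dots> = Z ^ n / t ^ (2 * (n - s)) / 2 ^ n" using Z t by (intro powr_log_cancel) auto
  finally have ub: "2 powr (real n * phi \<sigma> \<delta>) \<le> Z ^ n / t ^ (2 * (n - s)) / 2 ^ n" .
  define Q where "Q = (\<Sum>x\<in>cube n. (noise n \<epsilon> (indicator S) x)\<^sup>2)"
  obtain k where k: "Z ^ n / t ^ (2 * (n - s)) \<le> 4 * exp 1 ^ 3 * (real s * sqrt (real s))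
    * (real (n choose s) * real (s choose k) * real (n - s choose k) * (\<delta> ^ (2 * k) * (1 - \<delta>) ^ (n - 2 * k)))"
    using sphere_overlap_ge[of s n \<delta> t] s(1) sn \<delta> t st unfolding Z_def by auto
  also have "\<dots> \<le> 4 * exp 1 ^ 3 * (real s * sqrt (real s)) * Q"
    unfolding Q_def S_def \<delta>_def using z \<epsilon> by (intro mult_left_mono sum_noise_hsphere_ge) auto
  finally have "Z ^ n / t ^ (2 * (n - s)) / 2 ^ n \<le> 4 * exp 1 ^ 3 * (real s * sqrt (real s)) * Q / 2 ^ n"
    by (intro divide_right_mono) auto
  with ub have bound: "2 powr (real n * phi \<sigma> \<delta>) \<le> 4 * exp 1 ^ 3 * (real s * sqrt (real s)) * (Q / 2 ^ n)"
    by simp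
  have "noise n \<epsilon> f x = c * noise n \<epsilon> (indicator S) x" for x
    unfolding noise_def sum_distrib_left using f by (intro sum.cong) (auto simp: S_def)
  then have "cnorm n 2 (noise n \<epsilon> f) = (c\<^sup>2 * (Q / 2 ^ n)) powr (1 / 2)"
    by (simp add: cnorm_def Q_def power_mult_distrib sum_distrib_left)
  also have "\<dots> = \<bar>c\<bar> * sqrt (Q / 2 ^ n)"
  proof -
    have "0 \<le> Q" by (simp add: Q_def sum_nonneg)
    then have "(c\<^sup>2 * (Q / 2 ^ n)) powr (1 / 2) = sqrt (c\<^sup>2 * (Q / 2 ^ n))"
      by (intro powr_half_sqrt) simp
    then show ?thesis by (simp only: real_sqrt_mult real_sqrt_abs)
  qed
  finally have T: "cnorm n 2 (noise n \<epsilon> f) = \<bar>c\<bar> * sqrt (Q / 2 ^ n)" .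
  have "eta (rnorm n f p) \<epsilon> = 1/2 * phi \<sigma> \<delta> + rnorm n f p / (p - 1)"
    unfolding eta_def eta_q_def phi_tilde_def p[symmetric] y \<sigma>_def \<delta>_def by (rule refl)
  then have "eta (rnorm n f p) \<epsilon> * real n = real n * phi \<sigma> \<delta> / 2 + (real n - m) / p"
    by (simp only: distrib_right x1) simp
  \<comment> \<open>The \<open>p\<close>-norm contributes \<open>(m - n) / p\<close>, which cancels
    the second summand of \<open>eta\<close>.\<close>
  then have "log 2 (2 powr (eta (rnorm n f p) \<epsilon> * real n) * cnorm n p f)
      = real n * phi \<sigma> \<delta> / 2 + log 2 \<bar>c\<bar>"
    using ln[of p] p1 by (simp add: log_mult log_powr diff_divide_distrib)
  also have "\<dots> = log 2 (\<bar>c\<bar> * 2 powr (real n * phi \<sigma> \<delta> / 2))"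
    using c by (simp add: log_mult log_powr)
  finally have "log 2 (2 powr (eta (rnorm n f p) \<epsilon> * real n) * cnorm n p f)
      = log 2 (\<bar>c\<bar> * 2 powr (real n * phi \<sigma> \<delta> / 2))" .
  moreover have "0 < 2 powr (eta (rnorm n f p) \<epsilon> * real n) * cnorm n p f"
    using ln(2)[of p] p1 by simp
  moreover have "0 < \<bar>c\<bar> * 2 powr (real n * phi \<sigma> \<delta> / 2)" using c by simp
  ultimately have "2 powr (eta (rnorm n f p) \<epsilon> * real n) * cnorm n p f = \<bar>c\<bar> * 2 powr (real n * phi \<sigma> \<delta> / 2)"
    using log_inj[of 2] by (simp only: inj_on_def greaterThan_iff)
  also have "2 powr (real n * phi \<sigma> \<delta> / 2) = sqrt (2 powr (real n * phi \<sigma> \<delta>))"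
    by (simp add: powr_half_sqrt[symmetric] powr_powr)
  also have "\<bar>c\<bar> * \<dots> \<le> \<bar>c\<bar> * sqrt (4 * exp 1 ^ 3 * (real s * sqrt (real s)) * (Q / 2 ^ n))"
    using bound by (intro mult_left_mono) auto
  also have "\<dots> = sqrt (4 * exp 1 ^ 3) * sqrt (real s * sqrt (real s)) * (\<bar>c\<bar> * sqrt (Q / 2 ^ n))"
    by (simp only: real_sqrt_mult mult_ac)
  also have "sqrt (real s * sqrt (real s)) = real s powr (3/4)"
  proof -
    have "real s * sqrt (real s) = real s powr (1 + 1/2)"
      using s by (simp only: powr_add) (simp add: powr_half_sqrt)
    then show ?thesis by (simp add: powr_half_sqrt[symmetric] powr_powr)
  qed
  finally show ?thesis unfolding T .
qed

theorem theorem1p8: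
  shows "(\<forall>(n::nat) (f :: bool list \<Rightarrow> real) (\<epsilon>::real) (p::real).
            1 \<le> n \<and> (\<exists>x\<in>cube n. f x \<noteq> 0) \<and> 0 \<le> \<epsilon> \<and> \<epsilon> < 1/2 \<and> p = 1 + (1 - 2 * \<epsilon>)\<^sup>2 \<longrightarrow>
            cnorm n 2 (noise n \<epsilon> f) \<le> 2 powr (eta (rnorm n f p) \<epsilon> * real n) * cnorm n p f)
       \<and> (\<exists>C::real. \<forall>(n::nat) (s::nat) (z :: bool list) (c::real) (f :: bool list \<Rightarrow> real) (\<epsilon>::real) (p::real).
            1 \<le> s \<and> real s \<le> real n / 2 \<and> z \<in> cube n \<and> c \<noteq> 0 \<and>
            (\<forall>x\<in>cube n. f x = c * indicator (hsphere n z s) x) \<and>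
            0 \<le> \<epsilon> \<and> \<epsilon> < 1/2 \<and> p = 1 + (1 - 2 * \<epsilon>)\<^sup>2 \<longrightarrow>
            2 powr (eta (rnorm n f p) \<epsilon> * real n) * cnorm n p f
              \<le> C * real s powr (3/4) * cnorm n 2 (noise n \<epsilon> f))"
  by (intro conjI allI impI exI[of _ "sqrt (4 * exp 1 ^ 3)"])
    (elim conjE, rule cnorm_noise_le cnorm_noise_hsphere_ge; assumption)+

end
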